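(* $\mathcal{COP}_5=\widetilde{\mathcal Q}_5^{(1)}$; that is, a real symmetric $5\times 5$ matrix $M$ is copositive if and only if $M\in\widetilde{\mathcal Q}_5^{(1)}$.
   Context: $\mathbb N=\{0,1,2,\dots\}$. $\mathcal S^n$ is the space of real symmetric $n\times n$ matrices. $\mathcal{COP}_n=\{M\in\mathcal S^n: x^TMx\ge 0 \text{ for all } x\in\mathbb R^n_+\}$, where $\mathbb R^n_+$ is the nonnegative orthant. For $\beta\in\mathbb N^n$ put $|\beta|=\sum_i\beta_i$ and $x^\beta=x_1^{\beta_1}\cdots x_n^{\beta_n}$. For $n,r\in\mathbb N$: $\mathcal N_{n,r}$ is the set of homogeneous polynomials of degree $r$ in $x_1,\dots,x_n$ with nonnegative coefficients (including $0$); $\mathcal H_{n,r}$ is the cone of homogeneous polynomials of degree $r+2$ (including $0$) of the form $\sum_{\beta\in\mathbb N^n,\ |\beta|\in\{r,r+2\}}x^\beta\sigma_\beta$, where each $\sigma_\beta$ is a sum of squares of real polynomials of degree at most $r+2-|\beta|$ (so a nonnegative constant if $|\beta|=r+2$, and an sos of degree at most $2$ if $|\beta|=r$). For a homogeneous polynomial $p$, $\|p\|_1$ is the sum of the absolute values of its coefficients. Define $$\widetilde{\mathcal Q}_n^{(r)}=\{M\in\mathcal S^n:\ p\cdot x^TMx\in\mathcal H_{n,r}\text{ for some }p\in\mathcal N_{n,r}\text{ with }\|p\|_1=1\}.$$ *)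

theory Defs
  imports "HOL-Analysis.Analysis" "HOL-Library.Poly_Mapping"
begin

(* Exponent vectors and real polynomials in the variables x_i, i :: 'n, as finitely supported
   functions; polynomial multiplication is the convolution product of HOL-Library.Poly_Mapping.
   The dimension n is CARD('n). *)
type_synonym 'n expo = "'n \<Rightarrow>\<^sub>0 nat"
type_synonym 'n rpoly = "'n expo \<Rightarrow>\<^sub>0 real"

definition mdeg :: "'n::finite expo \<Rightarrow> nat" where
  "mdeg \<beta> = (\<Sum>i\<in>UNIV. Poly_Mapping.lookup \<beta> i)"

definition xpow :: "'n expo \<Rightarrow> 'n rpoly" where
  "xpow \<beta> = Poly_Mapping.single \<beta> 1"

definition homogeneous :: "nat \<Rightarrow> 'n::finite rpoly \<Rightarrow> bool" where
  "homogeneous d p \<longleftrightarrow> (\<forall>\<beta>\<in>Poly_Mapping.keys p. mdeg \<beta> = d)"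

definition deg_at_most :: "nat \<Rightarrow> 'n::finite rpoly \<Rightarrow> bool" where
  "deg_at_most d p \<longleftrightarrow> (\<forall>\<beta>\<in>Poly_Mapping.keys p. mdeg \<beta> \<le> d)"

definition sos :: "'n rpoly \<Rightarrow> bool" where
  "sos p \<longleftrightarrow> (\<exists>qs. p = (\<Sum>q\<leftarrow>qs. q ^ 2))"

definition norm1 :: "'n rpoly \<Rightarrow> real" where
  "norm1 p = (\<Sum>\<beta>\<in>Poly_Mapping.keys p. \<bar>Poly_Mapping.lookup p \<beta>\<bar>)"

definition qform :: "real ^ 'n ^ 'n \<Rightarrow> 'n::finite rpoly" where
  "qform M = (\<Sum>i\<in>UNIV. \<Sum>j\<in>UNIV.
     Poly_Mapping.single (Poly_Mapping.single i 1 + Poly_Mapping.single j 1) (M $ i $ j))"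

definition sym_mats :: "(real ^ 'n ^ 'n) set" where
  "sym_mats = {M. transpose M = M}"

definition COP :: "(real ^ 'n ^ 'n::finite) set" where
  "COP = {M \<in> sym_mats. \<forall>x. (\<forall>i. x $ i \<ge> 0) \<longrightarrow> x \<bullet> (M *v x) \<ge> 0}"

definition N_cone :: "nat \<Rightarrow> ('n::finite rpoly) set" where
  "N_cone r = {p. homogeneous r p \<and> (\<forall>\<beta>. Poly_Mapping.lookup p \<beta> \<ge> 0)}"

definition H_cone :: "nat \<Rightarrow> ('n::finite rpoly) set" where
  "H_cone r = {h. homogeneous (r + 2) h \<and>
     (\<exists>\<sigma>. (\<forall>\<beta>. mdeg \<beta> \<in> {r, r + 2} \<longrightarrow>
                 sos (\<sigma> \<beta>) \<and> deg_at_most (r + 2 - mdeg \<beta>) (\<sigma> \<beta>)) \<and>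
          h = (\<Sum>\<beta> | mdeg \<beta> \<in> {r, r + 2}. xpow \<beta> * \<sigma> \<beta>))}"

definition Q_tilde :: "nat \<Rightarrow> (real ^ 'n ^ 'n::finite) set" where
  "Q_tilde r = {M \<in> sym_mats. \<exists>p \<in> N_cone r. norm1 p = 1 \<and> p * qform M \<in> H_cone r}"

(* The index set of the sum in H_cone is finite, so that sum is the genuine one. *)
lemma finite_mdeg: "finite {\<beta> :: 'n::finite expo. mdeg \<beta> \<in> {r, r + 2}}"
proof (rule finite_imageD)
  show "inj_on Poly_Mapping.lookup {\<beta> :: 'n expo. mdeg \<beta> \<in> {r, r + 2}}"
    by (simp add: inj_on_def poly_mapping_eqI)
  have "Poly_Mapping.lookup \<beta> i \<le> r + 2" if "mdeg \<beta> \<in> {r, r + 2}" for \<beta> :: "'n expo" and i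
    using that member_le_sum[of i UNIV "Poly_Mapping.lookup \<beta>"] by (auto simp: mdeg_def)
  then have "Poly_Mapping.lookup ` {\<beta> :: 'n expo. mdeg \<beta> \<in> {r, r + 2}} \<subseteq> UNIV \<rightarrow>\<^sub>E {..r + 2}"
    by (auto simp: PiE_def)
  then show "finite (Poly_Mapping.lookup ` {\<beta> :: 'n expo. mdeg \<beta> \<in> {r, r + 2}})"
    by (rule finite_subset) (simp add: finite_PiE)
qed

end

(* The multiplier is p = sum_i d_i x_i. If positive semidefinite matrices P_i are such that all
   coefficients of p x^T M x - sum_i x_i x^T P_i x are nonnegative, then M is in Q~^(1). The set of M
   admitting such P_i is closed as p runs over the simplex, and scaling the variables by the square
   roots of the diagonal reduces the claim to matrices with unit diagonal and p = x_1 + ... + x_5.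

   A convexity argument reduces it further: if the closed convex set of certified matrices missed a
   unit-diagonal copositive matrix, a separating functional X, perturbed to have positive
   off-diagonal entries, would be minimised over all of them at some uncertified M. By conic duality
   X is, up to its diagonal, a sum of matrices u u^T with u >= 0 and u^T M u = 0, so every pair of
   indices lies in the support of such a zero u of M.

   Suppose M has this property and is not positive semidefinite, and write M_ij = - cos phi_ij. Then
   every zero of M has at most three positive entries, and a zero supported on {i,j,k} means
   phi_ij + phi_ik + phi_jk = pi. Two such triangles with a common side force a strict inequality on
   the angle at the opposite pair, and the combinatorics of five points leave only a 5-cycle of
   angles t_i = phi_(i,i+1) with phi_(i,i+2) = pi - t_i - t_(i+1) and sum t_i <= pi (the Horn matrix
   is t = 0). For these, P_i = m_i m_i^T + s_i s_i^T is a certificate, where m_i is the i-th row of M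
   and the j-th entry of s_i is sin phi_ij up to a sign given by orienting the edges of the cycle
   forwards and its diagonals backwards. *)
theory Submission
  imports Defs
begin

section \<open>Zeros of copositive matrices\<close>

definition psd :: "real ^ 'n ^ 'n \<Rightarrow> bool" where
  "psd A \<longleftrightarrow> transpose A = A \<and> (\<forall>x. 0 \<le> x \<bullet> (A *v x))"

definition zero_of :: "real ^ 'n ^ 'n \<Rightarrow> real ^ 'n \<Rightarrow> bool" where
  "zero_of M u \<longleftrightarrow> (\<forall>i. 0 \<le> u $ i) \<and> u \<bullet> (M *v u) = 0"

text \<open>The form in which minimality of \<open>M\<close> under a linear functional enters the
  analysis of order five.\<close>

definition pairs_covered :: "real ^ 'n ^ 'n \<Rightarrow> bool" where
  "pairs_covered M \<longleftrightarrow> (\<forall>i j. i \<noteq> j \<longrightarrow> (\<exists>u. zero_of M u \<and> 0 < u $ i \<and> 0 < u $ j))"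

lemma sym_component:
  assumes "transpose M = M"
  shows "M $ i $ j = M $ j $ i"
  by (metis assms transpose_def vec_lambda_beta)

lemma inner_matrix_commute:
  fixes M :: "real ^ 'n ^ 'n"
  assumes "transpose M = M"
  shows "x \<bullet> (M *v y) = y \<bullet> (M *v x)"
  by (metis assms dot_lmul_matrix inner_commute transpose_matrix_vector)

lemma quad_add:
  fixes M :: "real ^ 'n ^ 'n"
  assumes "transpose M = M"
  shows "(x + y) \<bullet> (M *v (x + y)) = x \<bullet> (M *v x) + 2 * (x \<bullet> (M *v y)) + y \<bullet> (M *v y)"
  using inner_matrix_commute[OF assms, of y x]
  by (simp add: matrix_vector_right_distrib inner_add_left inner_add_right)

lemma quad_scaleR:
  fixes M :: "real ^ 'n ^ 'n"
  shows "(t *\<^sub>R x) \<bullet> (M *v (t *\<^sub>R x)) = t\<^sup>2 * (x \<bullet> (M *v x))"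
  by (simp add: matrix_vector_mult_scaleR power2_eq_square)

lemma inner_matrix_sum:
  fixes M :: "real ^ 'n ^ 'm"
  shows "x \<bullet> (M *v y) = (\<Sum>i\<in>UNIV. \<Sum>j\<in>UNIV. M $ i $ j * x $ i * y $ j)"
  by (simp add: inner_vec_def matrix_vector_mult_def sum_distrib_left mult_ac)

lemma matrix_axis: "(M *v axis j t) $ i = M $ i $ j * t" for M :: "real ^ 'n ^ 'm"
  by (simp add: matrix_vector_mult_def axis_def if_distrib cong: if_cong)

lemma COP_sym: "M \<in> COP \<Longrightarrow> transpose M = M"
  by (simp add: COP_def sym_mats_def)

lemma COP_nonneg: "M \<in> COP \<Longrightarrow> (\<And>i. 0 \<le> x $ i) \<Longrightarrow> 0 \<le> x \<bullet> (M *v x)"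
  by (simp add: COP_def)

text \<open>A zero minimises the form over the orthant, so the derivative of the form along each
  axis is nonnegative there.\<close>

lemma COP_zero_mult_nonneg:
  assumes M: "M \<in> COP" and u: "zero_of M u"
  shows "0 \<le> (M *v u) $ i"
proof (rule ccontr)
  define m where "m = (M *v u) $ i"
  \<comment> \<open>Small enough that \<open>t * M $ i $ i\<close> is at most \<open>- m\<close>;
    then the form at \<open>axis i t + u\<close> is at most \<open>t * m\<close>, which is
    negative.\<close>
  define t where "t = - m / (1 + \<bar>M $ i $ i\<bar>)"
  assume "\<not> 0 \<le> (M *v u) $ i"
  then have m: "m < 0" by (simp add: m_def)
  then have t: "t > 0" by (simp add: t_def divide_neg_pos add_pos_nonneg)
  have "0 \<le> (axis i t + u) \<bullet> (M *v (axis i t + u))"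
    using u t by (intro COP_nonneg[OF M]) (simp add: zero_of_def axis_def)
  also have "\<dots> = t * (t * M $ i $ i + 2 * m)"
    using u inner_matrix_commute[OF COP_sym[OF M], of "axis i t" u]
    by (simp add: quad_add[OF COP_sym[OF M]] zero_of_def inner_axis' matrix_axis m_def algebra_simps)
  finally have "0 \<le> t * M $ i $ i + 2 * m"
    using t by (simp add: zero_le_mult_iff)
  moreover have "t * M $ i $ i \<le> t * (1 + \<bar>M $ i $ i\<bar>)"
    using t by (intro mult_left_mono) auto
  moreover have "t * (1 + \<bar>M $ i $ i\<bar>) = - m"
    unfolding t_def by (simp add: add_nonneg_eq_0_iff)
  ultimately show False using m by linarith
qed

text \<open>Complementary slackness: the inner product of \<open>u\<close> with
  \<open>M *v u\<close> is a vanishing sum of nonnegative terms.\<close>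

lemma COP_zero_mult_eq_0:
  assumes M: "M \<in> COP" and u: "zero_of M u" and i: "u $ i \<noteq> 0"
  shows "(M *v u) $ i = 0"
proof -
  have "(\<Sum>k\<in>UNIV. u $ k * (M *v u) $ k) = 0"
    using u by (simp add: zero_of_def inner_vec_def)
  then have "\<forall>k\<in>UNIV. u $ k * (M *v u) $ k = 0"
    by (subst (asm) sum_nonneg_eq_0_iff)
      (use u COP_zero_mult_nonneg[OF M u] in \<open>auto simp: zero_of_def\<close>)
  then show ?thesis using i by (metis UNIV_I mult_eq_0_iff)
qed

lemma zero_of_add:
  assumes "M \<in> COP" "zero_of M u" "zero_of M v" "u \<bullet> (M *v v) = 0"
  shows "zero_of M (u + v)"
  using assms quad_add[OF COP_sym[OF assms(1)], of u v] by (simp add: zero_of_def)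

lemma COP_zero_inner_nonneg:
  assumes M: "M \<in> COP" and u: "\<And>i. 0 \<le> u $ i" and v: "zero_of M v"
  shows "0 \<le> u \<bullet> (M *v v)"
  using COP_zero_mult_nonneg[OF M v] u by (auto simp: inner_vec_def intro: sum_nonneg)

text \<open>Adding a large multiple of \<open>u\<close> moves \<open>z\<close> into the orthant
  without changing the value of the form, because \<open>M *v u\<close> vanishes on the support of
  \<open>u\<close>.\<close>

lemma COP_nonneg_on_support:
  assumes M: "M \<in> COP" and u: "zero_of M u" and z: "\<And>i. z $ i \<noteq> 0 \<Longrightarrow> u $ i \<noteq> 0"
  shows "0 \<le> z \<bullet> (M *v z)"
proof -
  \<comment> \<open>The sum is a convenient upper bound for all the ratios of |z_i| to u_i.\<close>
  define t where "t = (\<Sum>i\<in>{i. u $ i \<noteq> 0}. \<bar>z $ i\<bar> / u $ i)"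
  have u0: "0 \<le> u $ i" for i using u by (simp add: zero_of_def)
  have "0 \<le> (z + t *\<^sub>R u) $ i" for i
  proof (cases "u $ i = 0")
    case True
    then have "z $ i = 0" using z[of i] by blast
    with True show ?thesis by simp
  next
    case False
    then have "\<bar>z $ i\<bar> / u $ i \<le> t"
      unfolding t_def by (intro member_le_sum) (auto intro: divide_nonneg_nonneg u0)
    then have "\<bar>z $ i\<bar> \<le> t * u $ i"
      using u0[of i] False by (simp add: pos_divide_le_eq)
    then show ?thesis by simp
  qed
  then have "0 \<le> (z + t *\<^sub>R u) \<bullet> (M *v (z + t *\<^sub>R u))" by (rule COP_nonneg[OF M])
  also have "\<dots> = z \<bullet> (M *v z) + 2 * (z \<bullet> (M *v (t *\<^sub>R u)))"
    using u by (simp add: quad_add[OF COP_sym[OF M]] zero_of_def matrix_vector_mult_scaleR)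
  also have "z \<bullet> (M *v (t *\<^sub>R u)) = 0"
    using COP_zero_mult_eq_0[OF M u] z
    by (auto simp: matrix_vector_mult_scaleR inner_vec_def intro!: sum.neutral)
  finally show ?thesis by simp
qed

lemma psd_if_positive_zero:
  assumes M: "M \<in> COP" and u: "zero_of M u" "\<And>i. u $ i \<noteq> 0"
  shows "psd M"
  using COP_nonneg_on_support[OF M u(1)] u(2) COP_sym[OF M] by (simp add: psd_def)

text \<open>On the support of \<open>u\<close> the form is convex, so zeros with the same positive value
  outside that support form a convex set.\<close>
lemma zero_of_add_codim_1:
  assumes M: "M \<in> COP" and u: "zero_of M u" "\<And>i. i \<noteq> e \<Longrightarrow> u $ i \<noteq> 0"
    and v: "zero_of M v" "0 < v $ e" and w: "zero_of M w" "0 < w $ e"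
  shows "zero_of M (v + w)"
proof -
  \<comment> \<open>This combination cancels coordinate \<open>e\<close>, so it is supported where
    \<open>u\<close> is positive. Its form is a negative multiple of the mixed term of
    \<open>v\<close> and \<open>w\<close>, which is therefore at most 0.\<close>
  have "i \<noteq> e" if "(w $ e *\<^sub>R v - v $ e *\<^sub>R w) $ i \<noteq> 0" for i
    using that by (cases "i = e") (simp_all add: mult.commute)
  then have "0 \<le> (w $ e *\<^sub>R v - v $ e *\<^sub>R w) \<bullet> (M *v (w $ e *\<^sub>R v - v $ e *\<^sub>R w))"
    using u(2) by (intro COP_nonneg_on_support[OF M u(1)]) blast
  also have "\<dots> = - (2 * (w $ e) * (v $ e)) * (v \<bullet> (M *v w))"
    using v(1) w(1) inner_matrix_commute[OF COP_sym[OF M], of w v]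
    by (simp add: zero_of_def matrix_vector_mult_diff_distrib matrix_vector_mult_scaleR
        inner_diff_left inner_diff_right)
  finally have "(2 * (w $ e) * (v $ e)) * (v \<bullet> (M *v w)) \<le> 0"
    by simp
  then have "v \<bullet> (M *v w) \<le> 0"
    using v(2) w(2) by (simp add: mult_le_0_iff)
  moreover have "0 \<le> v \<bullet> (M *v w)"
    using v(1) by (intro COP_zero_inner_nonneg[OF M _ w(1)]) (simp add: zero_of_def)
  ultimately show ?thesis using zero_of_add[OF M v(1) w(1)] by simp
qed

text \<open>For each index some zero is positive there and at \<open>e\<close>. Such zeros may be
  added, and the sum over all indices is a zero with no vanishing entry.\<close>

lemma psd_if_zero_codim_1:
  fixes M :: "real ^ 'n ^ 'n"
  assumes M: "M \<in> COP" and cov: "pairs_covered M"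
    and u: "zero_of M u" "\<And>i. i \<noteq> e \<Longrightarrow> u $ i \<noteq> 0" and ne: "\<exists>i::'n. i \<noteq> e"
  shows "psd M"
proof -
  have "\<exists>v. zero_of M v \<and> 0 < v $ e \<and> (\<forall>i\<in>A. 0 < v $ i)" if "e \<notin> A" for A
    using finite[of A] that
  proof (induction A rule: finite_induct)
    case empty
    then show ?case using cov ne by (auto simp: pairs_covered_def)
  next
    case (insert i A)
    then obtain v where v: "zero_of M v" "0 < v $ e" "\<forall>i\<in>A. 0 < v $ i" by auto
    obtain w where w: "zero_of M w" "0 < w $ i" "0 < w $ e"
      using cov insert.prems unfolding pairs_covered_def by (metis insertI1)
    have "0 \<le> v $ k" "0 \<le> w $ k" for k using v w by (auto simp: zero_of_def)
    then show ?case
      using zero_of_add_codim_1[OF M u v(1,2) w(1,3)] v w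
      by (intro exI[of _ "v + w"]) (auto simp: add_pos_nonneg add_nonneg_pos)
  qed
  from this[of "- {e}"] obtain v where "zero_of M v" "0 < v $ e" "\<forall>i\<in>- {e}. 0 < v $ i" by auto
  then show ?thesis
    by (intro psd_if_positive_zero[OF M, of v]) (metis ComplI less_irrefl singletonD)+
qed

section \<open>Copositive matrices of order five whose zeros cover all pairs\<close>

text \<open>Eliminating \<open>y\<close> gives x sin^2 A = q z and z sin^2 C = q x. Hence x sin A =
  z sin C and q = sin A sin C, that is, cos B = - cos (A + C). The absolute value allows for A + C
  beyond pi.\<close>

lemma triangle_half:
  fixes x y z A B C :: real
  assumes pos: "0 < x" "0 < y" "0 < z"
    and ran: "0 \<le> A" "A \<le> pi" "0 \<le> B" "B \<le> pi" "0 \<le> C" "C \<le> pi"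
    and eq: "x = cos A * y + cos B * z" "y = cos A * x + cos C * z" "z = cos B * x + cos C * y"
  shows "x * sin A = z * sin C" "B = \<bar>pi - A - C\<bar>"
proof -
  define q where "q = cos B + cos A * cos C"
  have 1: "x * (sin A)\<^sup>2 = q * z"
    unfolding sin_squared_eq q_def using eq(1,2) by algebra
  have 2: "z * (sin C)\<^sup>2 = q * x"
    unfolding sin_squared_eq q_def using eq(2,3) by algebra
  have "(x * sin A)\<^sup>2 = (z * sin C)\<^sup>2"
    using 1 2 by algebra
  then show xz: "x * sin A = z * sin C"
    by (rule power2_eq_imp_eq) (use pos ran in \<open>simp_all add: sin_ge_zero\<close>)
  have "z * q = z * (sin A * sin C)"
    using 1 xz by algebra
  then have "cos B = - cos (A + C)"
    using pos by (simp add: q_def cos_add)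
  also have "\<dots> = cos (pi - (A + C))"
    by (simp add: cos_diff)
  also have "\<dots> = cos \<bar>pi - A - C\<bar>"
    by (simp add: diff_diff_eq)
  finally show "B = \<bar>pi - A - C\<bar>"
    by (rule cos_inj_pi[rotated 4]) (use ran in auto)
qed

text \<open>The equations are the projection laws of a triangle with sides x, y, z, and the
  conclusions are its angle sum and its law of sines. If the angle sum were not pi, the three
  versions of \<open>triangle_half\<close> would make every angle equal to pi, against positivity of
  the sides.\<close>

lemma triangle_angles:
  fixes x y z A B C :: real
  assumes pos: "0 < x" "0 < y" "0 < z"
    and ran: "0 \<le> A" "A \<le> pi" "0 \<le> B" "B \<le> pi" "0 \<le> C" "C \<le> pi"
    and eq: "x = cos A * y + cos B * z" "y = cos A * x + cos C * z" "z = cos B * x + cos C * y"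
  shows "A + B + C = pi" "x * sin A = z * sin C" "x * sin B = y * sin C" "y * sin A = z * sin B"
proof -
  have eq': "x = cos B * z + cos A * y" "y = cos C * z + cos A * x" "z = cos C * y + cos B * x"
    using eq by linarith+
  note 1 = triangle_half[OF pos ran eq]
    and 2 = triangle_half[OF pos(1,3,2) ran(3,4,1,2,5,6) eq'(1) eq(3,2)]
    and 3 = triangle_half[OF pos(2,1,3) ran(1,2,5,6,3,4) eq(2,1) eq'(3)]
  have False if "A + B + C \<noteq> pi"
  proof -
    have "A = pi" "B = pi" using that 1 2 3 ran by linarith+
    with eq(1) pos show False by simp
  qed
  then show "A + B + C = pi" by blast
  show "x * sin A = z * sin C" "x * sin B = y * sin C" "y * sin A = z * sin B"
    by (fact 1 2 3)+
qed

lemma UNIV_5_eq: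
  fixes a b c d e :: 5
  assumes "distinct [a, b, c, d, e]"
  shows "UNIV = {a, b, c, d, e}"
proof -
  have "card {a, b, c, d, e} = 5" using assms by simp
  then show ?thesis
    by (intro card_subset_eq[symmetric]) auto
qed

lemma obtain_fifth:
  fixes a b c d :: 5
  assumes "distinct [a, b, c, d]"
  obtains e where "distinct [a, b, c, d, e]"
proof -
  have "card {a, b, c, d} = 4" using assms by simp
  then have "{a, b, c, d} \<noteq> UNIV" by auto
  then obtain e where "e \<notin> {a, b, c, d}" by blast
  then show ?thesis using that[of e] assms by auto
qed

text \<open>The matrices left to certify: a positive semidefinite \<open>M\<close> is its own
  certificate, with every P_i equal to \<open>M\<close>.\<close>

locale covered_COP5 =
  fixes M :: "real ^ 5 ^ 5"
  assumes COP: "M \<in> COP" and diag: "\<And>i. M $ i $ i = 1"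
    and covered: "pairs_covered M" and not_psd: "\<not> psd M"
begin

lemma sym: "M $ i $ j = M $ j $ i"
  by (rule sym_component[OF COP_sym[OF COP]])

text \<open>Four positive entries leave one exceptional index, and
  \<open>psd_if_zero_codim_1\<close> would make \<open>M\<close> positive semidefinite.\<close>

lemma support_less_4:
  assumes "zero_of M u" "distinct [a, b, c, d]"
    and "0 < u $ a" "0 < u $ b" "0 < u $ c" "0 < u $ d"
  shows False
proof -
  obtain e where e: "distinct [a, b, c, d, e]" using obtain_fifth[OF assms(2)] .
  have "psd M"
  proof (rule psd_if_zero_codim_1[OF COP covered assms(1), of e])
    show "u $ i \<noteq> 0" if "i \<noteq> e" for i
      using UNIV_I[of i] assms(3-) that unfolding UNIV_5_eq[OF e] by auto
    show "\<exists>i. i \<noteq> e" using e by auto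
  qed
  with not_psd show False ..
qed

text \<open>The form is nonnegative on the whole span of two axes, because some zero is positive at
  both; the test vectors are the sum and the difference of the axes.\<close>

lemma entry_bounds: "- 1 \<le> M $ i $ j" "M $ i $ j \<le> 1"
proof -
  have "- 1 \<le> M $ i $ j \<and> M $ i $ j \<le> 1"
  proof (cases "i = j")
    case True then show ?thesis by (simp add: diag)
  next
    case False
    then obtain u where u: "zero_of M u" "0 < u $ i" "0 < u $ j"
      using covered unfolding pairs_covered_def by blast
    have "0 \<le> (axis i 1 + axis j t) \<bullet> (M *v (axis i 1 + axis j t))" for t
      by (rule COP_nonneg_on_support[OF COP u(1)]) (use u in \<open>auto simp: axis_def split: if_splits\<close>)
    then have "0 \<le> 1 + 2 * t * M $ i $ j + t * t" for t
      by (simp add: quad_add[OF COP_sym[OF COP]] inner_axis' matrix_axis diag sym[of j i] algebra_simps)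
    from this[of 1] this[of "- 1"] show ?thesis by simp
  qed
  then show "- 1 \<le> M $ i $ j" "M $ i $ j \<le> 1" by auto
qed

section \<open>Angles, edges and faces\<close>

definition ang :: "5 \<Rightarrow> 5 \<Rightarrow> real" where
  "ang i j = arccos (- M $ i $ j)"

lemma ang_bounds: "0 \<le> ang i j" "ang i j \<le> pi"
  using entry_bounds[of i j] by (simp_all add: ang_def arccos_lbound arccos_ubound)

lemma cos_ang: "cos (ang i j) = - M $ i $ j"
  using entry_bounds[of i j] by (simp add: ang_def)

lemma ang_commute: "ang i j = ang j i"
  by (simp add: ang_def sym)

text \<open>Equivalently \<open>M $ i $ j = - 1\<close>, so that the sum of the two axis vectors is
  already a zero.\<close>

definition edge :: "5 \<Rightarrow> 5 \<Rightarrow> bool" where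
  "edge i j \<longleftrightarrow> ang i j = 0"

lemma edge_commute: "edge i j \<longleftrightarrow> edge j i"
  by (simp add: edge_def ang_commute)

lemma edge_iff: "edge i j \<longleftrightarrow> M $ i $ j = - 1"
proof
  show "edge i j \<Longrightarrow> M $ i $ j = - 1" using cos_ang[of i j] by (simp add: edge_def)
  show "M $ i $ j = - 1 \<Longrightarrow> edge i j" by (simp add: edge_def ang_def)
qed

text \<open>A zero on three indices is a triangle with its entries as sides; excluding edges makes
  all three angles positive.\<close>

definition face :: "5 \<Rightarrow> 5 \<Rightarrow> 5 \<Rightarrow> bool" where
  "face i j k \<longleftrightarrow> distinct [i, j, k] \<and> \<not> edge i j \<and> \<not> edge i k \<and> \<not> edge j k \<and>
     (\<exists>u. zero_of M u \<and> 0 < u $ i \<and> 0 < u $ j \<and> 0 < u $ k)"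

lemma face_commute: "face i j k \<longleftrightarrow> face j i k" "face i j k \<longleftrightarrow> face i k j"
  unfolding face_def using edge_commute by auto

lemma mult_support_3:
  assumes u: "zero_of M u" "distinct [i, j, k]" "0 < u $ i" "0 < u $ j" "0 < u $ k"
  shows "(M *v u) $ l = M $ l $ i * u $ i + M $ l $ j * u $ j + M $ l $ k * u $ k"
proof -
  have "u $ m = 0" if "m \<notin> {i, j, k}" for m
    using support_less_4[of u i j k m] u that by (force simp: zero_of_def less_le)
  then have "(M *v u) $ l = (\<Sum>m\<in>{i, j, k}. M $ l $ m * u $ m)"
    unfolding matrix_vector_mult_def by (simp, intro sum.mono_neutral_right) auto
  then show ?thesis using u(2) by simp
qed

text \<open>By complementary slackness \<open>M *v u\<close> vanishes at \<open>i\<close>,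
  \<open>j\<close>, \<open>k\<close>, and these three equations are the projection laws of a
  triangle.\<close>

lemma support_3:
  assumes u: "zero_of M u" "distinct [i, j, k]" "0 < u $ i" "0 < u $ j" "0 < u $ k"
  shows "ang i j + ang i k + ang j k = pi" "u $ i * sin (ang i j) = u $ k * sin (ang j k)"
    "u $ i * sin (ang i k) = u $ j * sin (ang j k)" "u $ j * sin (ang i j) = u $ k * sin (ang i k)"
proof -
  have 0: "M $ l $ i * u $ i + M $ l $ j * u $ j + M $ l $ k * u $ k = 0" if "l \<in> {i, j, k}" for l
    using COP_zero_mult_eq_0[OF COP u(1), of l] mult_support_3[OF u, of l] that u by auto
  have "u $ i = cos (ang i j) * u $ j + cos (ang i k) * u $ k"
    "u $ j = cos (ang i j) * u $ i + cos (ang j k) * u $ k"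
    "u $ k = cos (ang i k) * u $ i + cos (ang j k) * u $ j"
    using 0[of i] 0[of j] 0[of k] by (simp_all add: cos_ang diag sym[of j i] sym[of k i] sym[of k j])
  note * = triangle_angles[OF u(3-5) ang_bounds ang_bounds ang_bounds this]
  show "ang i j + ang i k + ang j k = pi" "u $ i * sin (ang i j) = u $ k * sin (ang j k)"
    "u $ i * sin (ang i k) = u $ j * sin (ang j k)" "u $ j * sin (ang i j) = u $ k * sin (ang i k)"
    by (fact *)+
qed

text \<open>The law of sines makes the angle at \<open>j\<close>, \<open>k\<close> equal to 0 or pi,
  and in the latter case the angle sum leaves 0 for the angle at \<open>i\<close>,
  \<open>j\<close>.\<close>

lemma support_3_edge:
  assumes u: "zero_of M u" "distinct [i, j, k]" "0 < u $ i" "0 < u $ j" "0 < u $ k"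
    and "edge i k"
  shows "edge i j \<or> edge j k"
proof -
  note * = support_3[OF u]
  have "sin (ang j k) = 0" using *(3) \<open>edge i k\<close> u by (simp add: edge_def)
  then have "ang j k = 0 \<or> ang j k = pi"
    using ang_bounds[of j k] sin_gt_zero[of "ang j k"] by linarith
  then show ?thesis using *(1) ang_bounds[of i j] \<open>edge i k\<close> by (auto simp: edge_def)
qed

text \<open>The covering zero has two or three positive entries. With two it yields an edge; with
  three it yields a face unless some pair is an edge, and then a second pair is one too.\<close>

lemma pair_cases:
  assumes "i \<noteq> j"
  shows "edge i j \<or> (\<exists>k. k \<noteq> i \<and> k \<noteq> j \<and> edge i k \<and> edge k j) \<or> (\<exists>k. face i j k)"
proof -
  obtain u where u: "zero_of M u" "0 < u $ i" "0 < u $ j"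
    using covered assms unfolding pairs_covered_def by blast
  have u0: "0 \<le> u $ k" for k using u by (simp add: zero_of_def)
  show ?thesis
  proof (cases "\<exists>k. k \<noteq> i \<and> k \<noteq> j \<and> 0 < u $ k")
    case True
    then obtain k where k: "k \<noteq> i" "k \<noteq> j" "0 < u $ k" by blast
    have "edge i k \<Longrightarrow> edge i j \<or> edge j k" "edge j k \<Longrightarrow> edge i j \<or> edge i k"
      using support_3_edge[of u i j k] support_3_edge[of u j i k] u k assms edge_commute by auto
    moreover have "face i j k" if "\<not> edge i j" "\<not> edge i k" "\<not> edge j k"
      using that u k assms unfolding face_def by auto
    ultimately show ?thesis
      using k edge_commute by blast
  next
    case False
    then have "u $ k = 0" if "k \<notin> {i, j}" for k
      using that u0[of k] by (force simp: less_le)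
    then have "(M *v u) $ l = (\<Sum>m\<in>{i, j}. M $ l $ m * u $ m)" for l
      unfolding matrix_vector_mult_def by (simp, intro sum.mono_neutral_right) auto
    moreover have "(M *v u) $ i = 0" "(M *v u) $ j = 0"
      using COP_zero_mult_eq_0[OF COP u(1)] u by auto
    ultimately have *: "u $ i + M $ i $ j * u $ j = 0" "M $ i $ j * u $ i + u $ j = 0"
      using assms by (simp_all add: diag sym[of j i])
    have "(M $ i $ j)\<^sup>2 * u $ j = u $ j" using * by algebra
    then have "(M $ i $ j)\<^sup>2 = 1" using u by simp
    moreover have "M $ i $ j \<noteq> 1" using * u by auto
    ultimately show ?thesis by (auto simp: edge_iff power2_eq_1_iff)
  qed
qed

lemma face_ang:
  assumes "face i j k"
  shows "ang i j + ang i k + ang j k = pi" "0 < ang i j" "0 < ang i k" "0 < ang j k"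
  using assms support_3(1)[of _ i j k] ang_bounds[of i j] ang_bounds[of i k] ang_bounds[of j k]
  unfolding face_def edge_def by force+

text \<open>Nonnegativity of \<open>M *v u\<close> at \<open>l\<close>, which is strict here,
  becomes an inequality between angles once the law of sines has expressed all entries of
  \<open>u\<close> through \<open>u $ k\<close>.\<close>

lemma faces_sharing_pair:
  assumes "face i j k" "face i j l" "k \<noteq> l"
  shows "pi - \<bar>ang i k - ang i l\<bar> < ang k l"
proof -
  obtain u where u: "zero_of M u" "distinct [i, j, k]" "0 < u $ i" "0 < u $ j" "0 < u $ k"
    using assms unfolding face_def by blast
  obtain v where v: "zero_of M v" "distinct [i, j, l]" "0 < v $ i" "0 < v $ j" "0 < v $ l"
    using assms unfolding face_def by blast
  define a \<alpha> \<beta> where "a = ang i j" and "\<alpha> = ang i k" and "\<beta> = ang i l"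
  have jk: "ang j k = pi - (a + \<alpha>)" and jl: "ang j l = pi - (a + \<beta>)"
    using face_ang(1)[OF assms(1)] face_ang(1)[OF assms(2)] by (simp_all add: a_def \<alpha>_def \<beta>_def)
  have a: "0 < sin a"
    using face_ang[OF assms(1)] by (intro sin_gt_zero) (simp_all add: a_def)
  \<comment> \<open>Otherwise \<open>M *v u\<close> would vanish on the support of \<open>v\<close>,
    and \<open>v + u\<close> would be a zero with four positive entries.\<close>
  have "(M *v u) $ l \<noteq> 0"
  proof
    assume l: "(M *v u) $ l = 0"
    have "v $ m * (M *v u) $ m = 0" for m
    proof (cases "m \<in> {i, j, l}")
      case True
      then show ?thesis using l u COP_zero_mult_eq_0[OF COP u(1), of m] by auto
    next
      case False
      then have "v $ m = 0"
        using support_less_4[of v i j l m] v by (force simp: zero_of_def less_le)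
      then show ?thesis by simp
    qed
    then have "v \<bullet> (M *v u) = 0"
      unfolding inner_vec_def by (intro sum.neutral) auto
    then have z: "zero_of M (v + u)" by (intro zero_of_add[OF COP v(1) u(1)])
    have "0 \<le> u $ m" "0 \<le> v $ m" for m using u v by (auto simp: zero_of_def)
    then show False
      using support_less_4[OF z, of i j k l] u v assms(3) by (auto simp: add_pos_nonneg add_nonneg_pos)
  qed
  then have "0 < (M *v u) $ l"
    using COP_zero_mult_nonneg[OF COP u(1), of l] by linarith
  \<comment> \<open>The factor \<open>sin a\<close> is what the law of sines needs to replace
    \<open>u $ i\<close> and \<open>u $ j\<close> by multiples of \<open>u $ k\<close>.\<close>
  then have "0 < sin a * (M *v u) $ l" using a by simp
  also have "\<dots> = - cos \<beta> * (u $ i * sin a) - cos (ang j l) * (u $ j * sin a) - cos (ang k l) * sin a * u $ k"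
    unfolding mult_support_3[OF u] by (simp add: cos_ang \<beta>_def sym[of l] algebra_simps)
  also have "u $ i * sin a = u $ k * sin (a + \<alpha>)"
    using support_3(2)[OF u] jk by (simp add: a_def)
  also have "u $ j * sin a = u $ k * sin \<alpha>"
    using support_3(4)[OF u] by (simp add: a_def \<alpha>_def)
  also have "- cos \<beta> * (u $ k * sin (a + \<alpha>)) - cos (ang j l) * (u $ k * sin \<alpha>) - cos (ang k l) * sin a * u $ k
      = - (u $ k * sin a) * (cos (\<alpha> - \<beta>) + cos (ang k l))"
    unfolding jl by (simp add: sin_add cos_add cos_diff algebra_simps)
  finally have "cos (\<alpha> - \<beta>) + cos (ang k l) < 0"
    using u(5) a by (simp add: zero_less_mult_iff mult_less_0_iff)
  then have "cos (ang k l) < cos (pi - \<bar>\<alpha> - \<beta>\<bar>)"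
    by (simp add: cos_diff)
  then show ?thesis
    using ang_bounds[of k l] ang_bounds[of i k] ang_bounds[of i l] cos_monotone_0_pi_le[of "ang k l" "pi - \<bar>\<alpha> - \<beta>\<bar>"]
    unfolding \<alpha>_def \<beta>_def by linarith
qed

section \<open>Combinatorics of edges and faces on five points\<close>

lemma ang_refl: "ang i i = pi"
  by (simp add: ang_def diag)

lemma edge_irrefl: "\<not> edge i i"
  by (simp add: edge_def ang_refl)

lemma edge_zero: "edge i j \<Longrightarrow> zero_of M (axis i 1 + axis j 1)"
  using edge_iff[of i j]
  by (simp add: zero_of_def quad_add[OF COP_sym[OF COP]] inner_axis' matrix_axis diag)
    (simp add: axis_def)

text \<open>The zero of the edge between \<open>i\<close> and \<open>j\<close> gives
  \<open>0 \<le> M $ k $ i + M $ k $ j\<close>, where the second summand is - 1.\<close>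

lemma path_ang:
  assumes "edge i j" "edge j k" "i \<noteq> k"
  shows "ang i k = pi"
proof -
  have "0 \<le> M $ k $ i + M $ k $ j"
    using COP_zero_mult_nonneg[OF COP edge_zero[OF assms(1)], of k]
    by (simp add: matrix_vector_right_distrib matrix_axis)
  then have "M $ i $ k = 1"
    using assms(2) entry_bounds(2)[of i k] by (simp add: edge_iff sym[of k])
  then show ?thesis by (simp add: ang_def)
qed

lemma no_triangle: "edge i j \<Longrightarrow> edge j k \<Longrightarrow> \<not> edge k i"
  using path_ang[of i j k] by (cases "i = k") (auto simp: edge_def ang_refl ang_commute[of k i])

text \<open>By \<open>path_ang\<close> the four entries involved are 1, - 1, - 1 and 1. So zeros of
  edges with a common end may be added.\<close>

lemma path_inner: "edge i j \<Longrightarrow> edge i k \<Longrightarrow> j \<noteq> k \<Longrightarrow>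
    (axis i 1 + axis j 1) \<bullet> (M *v (axis i 1 + axis k 1)) = 0"
  using path_ang[of j i k] cos_ang[of j k]
  by (simp add: matrix_vector_right_distrib inner_add_left inner_axis' matrix_axis diag
      edge_iff sym[of j i])

text \<open>The zeros of three edges at one vertex would add up to a zero with four positive
  entries.\<close>

lemma no_star:
  assumes "edge i j" "edge i k" "edge i l" "distinct [j, k, l]"
  shows False
proof -
  define p q r :: "real ^ 5" where "p = axis i 1 + axis j 1" and "q = axis i 1 + axis k 1"
    and "r = axis i 1 + axis l 1"
  have z: "zero_of M p" "zero_of M q" "zero_of M r"
    using assms by (auto simp: p_def q_def r_def edge_zero)
  have i: "p \<bullet> (M *v q) = 0" "p \<bullet> (M *v r) = 0" "q \<bullet> (M *v r) = 0"
    unfolding p_def q_def r_def by (rule path_inner; use assms in simp)+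
  have "zero_of M (p + q + r)"
    using z i by (auto intro!: zero_of_add[OF COP] simp: inner_add_left)
  moreover have "distinct [i, j, k, l]"
    using assms edge_irrefl by auto
  ultimately show False
    by (rule support_less_4) (auto simp: axis_def p_def q_def r_def)
qed

text \<open>Both diagonals of a square have entry 1, which makes the zeros of opposite sides
  orthogonal with respect to \<open>M\<close>; their sum would have four positive entries.\<close>

lemma no_square:
  assumes "edge i j" "edge j k" "edge k l" "edge l i" "i \<noteq> k" "j \<noteq> l"
  shows False
proof -
  have "ang i k = pi" "ang j l = pi"
    using assms by (auto intro: path_ang)
  then have "M $ i $ k = 1" "M $ j $ l = 1"
    using cos_ang[of i k] cos_ang[of j l] by auto
  then have "(axis i 1 + axis j 1) \<bullet> (M *v (axis k 1 + axis l 1)) = 0"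
    using assms by (simp add: matrix_vector_right_distrib inner_add_left inner_axis' matrix_axis
        edge_iff sym[of l i])
  then have "zero_of M ((axis i 1 + axis j 1) + (axis k 1 + axis l 1))"
    using assms by (intro zero_of_add[OF COP] edge_zero) auto
  moreover have "distinct [i, j, k, l]"
    using assms edge_irrefl by auto
  ultimately show False
    by (rule support_less_4) (auto simp: axis_def)
qed

lemma face_no_path: "face i j k \<Longrightarrow> edge i l \<Longrightarrow> \<not> edge l j"
  using path_ang[of i l j] face_ang[of i j k] by (auto simp: face_def)

lemma face_distinct: "face i j k \<Longrightarrow> i \<noteq> j \<and> i \<noteq> k \<and> j \<noteq> k"
  by (auto simp: face_def)

lemma face_not_edge: "face i j k \<Longrightarrow> \<not> edge i j \<and> \<not> edge i k \<and> \<not> edge j k"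
  by (auto simp: face_def)

text \<open>The strict lower bound on the angle at \<open>k\<close>, \<open>l\<close> is
  nonnegative, as two angles differ by at most pi.\<close>

lemma no_edge_opposite: "face i j k \<Longrightarrow> face i j l \<Longrightarrow> \<not> edge k l"
  using faces_sharing_pair[of i j k l] ang_bounds[of i k] ang_bounds[of i l] edge_irrefl[of k]
  unfolding edge_def by (cases "k = l") (simp, linarith)

text \<open>A face on \<open>i\<close>, \<open>k\<close>, \<open>l\<close> would make the angle at
  \<open>k\<close>, \<open>l\<close> equal to pi minus the sum of two positive angles, less than pi
  minus their difference.\<close>

lemma no_face_opposite:
  assumes "face i j k" "face i j l"
  shows "\<not> face i k l"
  using faces_sharing_pair[OF assms] face_ang[of i k l] face_ang[OF assms(1)] face_ang[OF assms(2)]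
    face_distinct[of i k l] by linarith

text \<open>Three numbers between 0 and pi have pairwise distances adding up to at most 2 pi, so the
  three opposite angles add up to more than pi.\<close>

lemma no_three_faces:
  assumes "face i j k" "face i j l" "face i j m"
  shows "\<not> face k l m"
  using faces_sharing_pair[OF assms(1,2)] faces_sharing_pair[OF assms(1,3)] faces_sharing_pair[OF assms(2,3)]
    face_ang[of k l m] face_distinct[of k l m] ang_bounds[of i k] ang_bounds[of i l] ang_bounds[of i m]
  by linarith

text \<open>If \<open>b\<close> had no further edge, the pair \<open>b\<close>, \<open>d\<close>
  could only be covered by the face \<open>b\<close>, \<open>d\<close>, \<open>e\<close>. This rules
  out the face \<open>a\<close>, \<open>d\<close>, \<open>e\<close>, so \<open>a\<close> reaches
  \<open>d\<close> and \<open>e\<close> only by paths through \<open>c\<close>, and \<open>c\<close>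
  becomes the centre of a star.\<close>

lemma edge_extend_aux:
  assumes d: "distinct [a, b, c, d, e]" and ab: "edge a b" and ac: "edge a c"
  shows "\<exists>x. x \<noteq> a \<and> edge b x"
proof (rule ccontr)
  assume no: "\<not> ?thesis"
  note U = UNIV_I[where 'a = 5, unfolded UNIV_5_eq[OF d]]
  have ad: "\<not> edge a d" and ae: "\<not> edge a e"
    using no_star[of a b c d] no_star[of a b c e] ab ac d by auto
  have "face b d e"
  proof -
    have "\<not> (edge b k \<and> edge k d)" for k using no ad by metis
    then obtain y where y: "face b d y"
      using pair_cases[of b d] no d by (metis distinct_length_2_or_more)
    moreover have "y \<noteq> a" "y \<noteq> b" "y \<noteq> d"
      using face_not_edge[OF y] ab edge_commute face_distinct[OF y] by auto
    moreover have "y \<noteq> c"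
      using y face_no_path[of b c d a] face_commute ab ac edge_commute by metis
    ultimately show ?thesis using U[of y] by auto
  qed
  then have nf: "\<not> face a d e"
    using no_edge_opposite[of d e a b] ab face_commute by metis
  have "edge c x" if x: "x = d \<or> x = e" for x
  proof (rule ccontr)
    assume cx: "\<not> edge c x"
    have "\<not> (edge a k \<and> edge k x)" for k
      using U[of k] no ad ae cx d x by auto
    then obtain y where y: "face a x y"
      using pair_cases[of a x] ad ae d x by (metis distinct_length_2_or_more)
    moreover have "y \<noteq> a" "y \<noteq> b" "y \<noteq> c" "y \<noteq> x"
      using face_not_edge[OF y] ab ac face_distinct[OF y] by auto
    ultimately show False using U[of y] x nf face_commute by auto
  qed
  then show False using no_star[of c a d e] ac d edge_commute by auto
qed

text \<open>If \<open>b\<close> had no further edge, then neither would \<open>a\<close>. Both would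
  then form faces with pairs from the three other points, no pair serving both; but each needs two
  of the three pairs to reach all three points.\<close>

lemma edge_extend:
  assumes ab: "edge a b"
  shows "\<exists>x. x \<noteq> a \<and> edge b x"
proof (rule ccontr)
  assume no: "\<not> ?thesis"
  have "distinct [a, b]" using ab edge_irrefl by auto
  moreover have "card {a, b} < card (UNIV :: 5 set)"
    using card_insert_le_m1[of 2 "{b}" a] by simp
  then obtain c where "c \<notin> {a, b}" by (metis UNIV_I less_irrefl subsetI subset_UNIV subset_antisym)
  moreover have "card {a, b, c} < card (UNIV :: 5 set)"
    using card_insert_le_m1[of 3 "{b, c}" a] card_insert_le_m1[of 2 "{c}" b] by simp
  then obtain d where "d \<notin> {a, b, c}" by (metis UNIV_I less_irrefl subsetI subset_UNIV subset_antisym)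
  ultimately have "distinct [a, b, c, d]" by auto
  then obtain e where d: "distinct [a, b, c, d, e]" using obtain_fifth by blast
  note U = UNIV_I[where 'a = 5, unfolded UNIV_5_eq[OF d]]
  have na: "\<not> edge a c" "\<not> edge a d" "\<not> edge a e"
    using edge_extend_aux[of a b c d e] edge_extend_aux[of a b d c e] edge_extend_aux[of a b e c d] ab no d
    by auto
  have nb: "\<not> edge b c" "\<not> edge b d" "\<not> edge b e"
    using no d by auto
  have *: "\<exists>y\<in>{c, d, e} - {x}. face z x y" if "z \<in> {a, b}" "x \<in> {c, d, e}" for z x
  proof -
    have "\<not> (edge z k \<and> edge k x)" for k
      using U[of k] na nb that edge_irrefl edge_commute by auto
    moreover have "z \<noteq> x" "\<not> edge z x"
      using na nb d that by auto
    ultimately obtain y where y: "face z x y"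
      using pair_cases[of z x] by blast
    then have "y \<in> {c, d, e} - {x}"
      using U[of y] that face_distinct[OF y] face_not_edge[OF y] ab edge_commute by auto
    with y show ?thesis by blast
  qed
  have **: "\<not> (face a x y \<and> face b x y)" for x y
    using no_edge_opposite[of x y a b] ab face_commute by metis
  have "face b c d \<or> face b c e" "face b d c \<or> face b d e" "face b e c \<or> face b e d"
    "face a c d \<or> face a c e" "face a d c \<or> face a d e" "face a e c \<or> face a e d"
    using *[of a c] *[of a d] *[of a e] *[of b c] *[of b d] *[of b e] by auto
  with ** face_commute show False by metis
qed

text \<open>A path keeps extending and, without triangles and squares, visits all five points. Its
  next step can only return to \<open>a\<close>, since the other choices close a triangle or a
  star.\<close>

lemma edge_cycle:
  assumes ab: "edge a b"
  shows "\<exists>c d e. distinct [a, b, c, d, e] \<and> edge b c \<and> edge c d \<and> edge d e \<and> edge e a"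
proof -
  obtain c where c: "c \<noteq> a" "edge b c" using edge_extend[OF ab] by blast
  obtain d where d: "d \<noteq> b" "edge c d" using edge_extend[OF c(2)] by blast
  have da: "d \<noteq> a" using no_triangle[of a b c] ab c d by auto
  obtain e where e: "e \<noteq> c" "edge d e" using edge_extend[OF d(2)] by blast
  have eb: "e \<noteq> b" using no_triangle[of b c d] c d e by auto
  have ea: "e \<noteq> a" using no_square[of a b c d] ab c d e by auto
  have D: "distinct [a, b, c, d, e]"
    using ab c d da e ea eb edge_irrefl by auto
  obtain x where x: "x \<noteq> d" "edge e x" using edge_extend[OF e(2)] by blast
  have "x \<noteq> b" using no_star[of b a c e] ab c x D edge_commute by auto
  moreover have "x \<noteq> c" using no_triangle[of c d e] d e x by auto
  moreover have "x \<noteq> e" using x edge_irrefl by auto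
  ultimately have "x = a" using x UNIV_I[of x] unfolding UNIV_5_eq[OF D] by auto
  with D c d e x show ?thesis by blast
qed

text \<open>The exclusions leave only \<open>e\<close> to complete \<open>c\<close>,
  \<open>d\<close> to a face. Then \<open>a\<close>, \<open>e\<close> and \<open>b\<close>,
  \<open>e\<close> are completed by \<open>c\<close> and \<open>d\<close>, one each, and the two
  assignments give the cycle up to relabelling.\<close>

lemma adjacent_faces_cycle:
  assumes no: "\<And>i j. \<not> edge i j" and D: "distinct [a, b, c, d, e]"
    and abc: "face a b c" and abd: "face a b d"
  shows "\<exists>a b c d e. distinct [a, b, c, d, e] \<and> face a b c \<and> face b c d \<and> face c d e \<and> face d e a \<and> face e a b"
proof -
  note U = UNIV_I[where 'a = 5, unfolded UNIV_5_eq[OF D]]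
  have pair: "\<exists>z\<in>{a, b, c, d, e} - {x, y}. face x y z" if "x \<noteq> y" for x y
    using pair_cases[OF that] no face_distinct U by blast
  have nf: "\<not> face a c d" "\<not> face b c d"
    using no_face_opposite[OF abc abd] no_face_opposite[of b a c d] abc abd face_commute by auto
  have cde: "face c d e"
    using pair[of c d] D nf face_commute by auto
  have "\<not> face a b e"
    using no_three_faces[OF abc abd, of e] cde by blast
  then have ae: "face a e c \<or> face a e d" and be: "face b e c \<or> face b e d"
    using pair[of a e] pair[of b e] D face_commute by auto
  have "\<not> (face a e c \<and> face b e c)" "\<not> (face a e d \<and> face b e d)"
    using no_three_faces[of c e a b d] no_three_faces[of d e a b c] abc abd cde face_commute by metis+
  with ae be consider "face a e c" "face b e d" | "face a e d" "face b e c" by blast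
  then show ?thesis
  proof cases
    case 1
    have "distinct [d, b, a, c, e]" using D by auto
    moreover have "face d b a" "face b a c" "face a c e" "face c e d" "face e d b"
      using 1 abc abd cde face_commute by metis+
    ultimately show ?thesis by blast
  next
    case 2
    have "distinct [c, b, a, d, e]" using D by auto
    moreover have "face c b a" "face b a d" "face a d e" "face d e c" "face e c b"
      using 2 abc abd cde face_commute by metis+
    ultimately show ?thesis by blast
  qed
qed

text \<open>It suffices to find two faces with a common pair. For a point \<open>d\<close> outside
  the face \<open>a\<close>, \<open>b\<close>, \<open>c\<close>, a face on \<open>a\<close>,
  \<open>d\<close> or \<open>b\<close>, \<open>d\<close> either shares a pair with the first face or
  has the fifth point \<open>v\<close> as its third; in the last case both contain \<open>d\<close>,
  \<open>v\<close>.\<close>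

lemma face_cycle:
  assumes no: "\<And>i j. \<not> edge i j"
  shows "\<exists>a b c d e. distinct [a, b, c, d, e] \<and> face a b c \<and> face b c d \<and> face c d e \<and> face d e a \<and> face e a b"
proof -
  have pair: "\<exists>z. face x y z" if "x \<noteq> y" for x y
    using pair_cases[OF that] no by blast
  have adj: ?thesis if "face x y z" "face x y w" "z \<noteq> w" for x y z w
  proof -
    have "distinct [x, y, z, w]" using that face_distinct by auto
    then obtain v where "distinct [x, y, z, w, v]" using obtain_fifth by blast
    then show ?thesis by (rule adjacent_faces_cycle[OF no _ that(1,2)])
  qed
  obtain a b c where abc: "face a b c"
    using pair[of 0 1] by auto
  obtain d where d: "d \<notin> {a, b, c}"
  proof -
    have "card {a, b, c} < card (UNIV :: 5 set)"
      using card_insert_le_m1[of 3 "{b, c}" a] card_insert_le_m1[of 2 "{c}" b] by simp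
    then show ?thesis using that by (metis UNIV_I less_irrefl subsetI subset_UNIV subset_antisym)
  qed
  obtain x where x: "face a d x" using pair[of a d] d by auto
  obtain y where y: "face b d y" using pair[of b d] d by auto
  obtain z where z: "face c d z" using pair[of c d] d by auto
  consider "x \<in> {b, c}" | "y \<in> {a, c}" | "z \<in> {a, b}" | "x \<notin> {a, b, c, d}" "y \<notin> {a, b, c, d}"
    using face_distinct[OF x] face_distinct[OF y] by blast
  then show ?thesis
  proof cases
    case 1
    then show ?thesis using adj[of a b c d] adj[of a c b d] abc x d face_commute by auto
  next
    case 2
    then show ?thesis using adj[of a b c d] adj[of b c a d] abc y d face_commute by auto
  next
    case 3
    then show ?thesis using adj[of a c b d] adj[of b c a d] abc z d face_commute by auto
  next
    case 4
    have "distinct [a, b, c, d]" using face_distinct[OF abc] d by auto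
    then obtain v where v: "distinct [a, b, c, d, v]" using obtain_fifth by blast
    then have "x = v" "y = v"
      using 4 UNIV_I[of x] UNIV_I[of y] unfolding UNIV_5_eq[OF v] by auto
    then show ?thesis using adj[of d v a b] x y face_commute face_distinct[OF abc] by auto
  qed
qed

text \<open>If there is an edge, the cycle consists of edges: sides have angle 0 and diagonals angle
  pi. Otherwise five consecutive faces give the equations by their angle sums.\<close>

lemma cyclic_angles:
  "\<exists>a b c d e. distinct [a, b, c, d, e] \<and>
     ang a c = pi - ang a b - ang b c \<and> ang b d = pi - ang b c - ang c d \<and>
     ang c e = pi - ang c d - ang d e \<and> ang d a = pi - ang d e - ang e a \<and>
     ang e b = pi - ang e a - ang a b \<and>
     ang a b + ang b c + ang c d + ang d e + ang e a \<le> pi"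
proof (cases "\<exists>a b. edge a b")
  case True
  then obtain a b where "edge a b" by blast
  moreover obtain c d e where "distinct [a, b, c, d, e]" "edge b c" "edge c d" "edge d e" "edge e a"
    using edge_cycle[OF calculation] by blast
  moreover have "ang a c = pi" "ang b d = pi" "ang c e = pi" "ang d a = pi" "ang e b = pi"
    using calculation by (auto intro: path_ang)
  ultimately show ?thesis
    by (intro exI[of _ a] exI[of _ b] exI[of _ c] exI[of _ d] exI[of _ e]) (simp add: edge_def)
next
  case False
  then obtain a b c d e where D: "distinct [a, b, c, d, e]"
    and f: "face a b c" "face b c d" "face c d e" "face d e a" "face e a b"
    using face_cycle by blast
  have f': "face b c a" "face c d b" "face d e c" "face e a d" "face a b e"
    using f face_commute by metis+
  have ne: "a \<noteq> d" "b \<noteq> e" "c \<noteq> a" "d \<noteq> b" "e \<noteq> c" using D by auto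
  note * = face_ang(1)[OF f(1)] face_ang(1)[OF f(2)] face_ang(1)[OF f(3)] face_ang(1)[OF f(4)] face_ang(1)[OF f(5)]
  note ** = ang_commute[of b a] ang_commute[of c b] ang_commute[of d c] ang_commute[of e d] ang_commute[of a e]
    ang_commute[of c a] ang_commute[of d b] ang_commute[of e c] ang_commute[of a d] ang_commute[of b e]
  \<comment> \<open>Each sharing inequality says that the total is below pi or that three
    consecutive sides exceed the other two by more than pi. The latter for all five would add up to
    a total above 5 pi, while two consecutive sides sum to at most pi.\<close>
  have "ang a b + ang b c + ang c d + ang d e + ang e a \<le> pi"
    using faces_sharing_pair[OF f'(1) f(2) ne(1)] faces_sharing_pair[OF f'(2) f(3) ne(2)]
      faces_sharing_pair[OF f'(3) f(4) ne(3)] faces_sharing_pair[OF f'(4) f(5) ne(4)]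
      faces_sharing_pair[OF f'(5) f(1) ne(5)] * ang_bounds[of a c] ang_bounds[of b d] ang_bounds[of c e]
      ang_bounds[of d a] ang_bounds[of e b]
    unfolding ** by linarith
  then show ?thesis
    using D * unfolding ** by (intro exI[of _ a] exI[of _ b] exI[of _ c] exI[of _ d] exI[of _ e]) auto
qed

end

section \<open>Certificates\<close>

text \<open>For symmetric \<open>M\<close> and \<open>P $ i\<close> this is three times the entry of
  the symmetric tensor of the cubic form (p . x) x^T M x - sum_i x_i x^T P_i x, so it has the sign
  of the coefficient of x_i x_j x_k.\<close>

definition slack :: "real ^ 'n \<Rightarrow> real ^ 'n ^ 'n ^ 'n \<Rightarrow> real ^ 'n ^ 'n \<Rightarrow> 'n \<Rightarrow> 'n \<Rightarrow> 'n \<Rightarrow> real" where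
  "slack p P M i j k = (p $ i * M $ j $ k - P $ i $ j $ k) + (p $ j * M $ i $ k - P $ j $ i $ k)
     + (p $ k * M $ i $ j - P $ k $ i $ j)"

definition certifies :: "real ^ 'n \<Rightarrow> real ^ 'n ^ 'n ^ 'n \<Rightarrow> real ^ 'n ^ 'n \<Rightarrow> bool" where
  "certifies p P M \<longleftrightarrow> (\<forall>i. psd (P $ i)) \<and> (\<forall>i j k. 0 \<le> slack p P M i j k)"

lemma psd_certificate:
  assumes "psd M"
  shows "certifies (\<chi> i. 1) (\<chi> i. M) M"
  using assms by (simp add: certifies_def slack_def)

text \<open>Each P_i is a sum of two squares of linear forms. The unit diagonal, the skew symmetry
  and the condition on squares make the slack vanish when two indices coincide, which leaves the
  triples of distinct indices.\<close>

lemma skew_certificate: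
  fixes M :: "real ^ 'n ^ 'n" and S :: "'n \<Rightarrow> 'n \<Rightarrow> real"
  assumes sym: "\<And>i j. M $ i $ j = M $ j $ i" and diag: "\<And>i. M $ i $ i = 1"
    and skew: "\<And>i j. S j i = - S i j" and sq: "\<And>i j. (S i j)\<^sup>2 = 1 - (M $ i $ j)\<^sup>2"
    and triple: "\<And>i j k. distinct [i, j, k] \<Longrightarrow>
      M $ i $ j * M $ i $ k + M $ i $ j * M $ j $ k + M $ i $ k * M $ j $ k
        + S i j * S i k + S j i * S j k + S k i * S k j \<le> M $ i $ j + M $ i $ k + M $ j $ k"
  shows "certifies (\<chi> i. 1) (\<chi> i j k. M $ i $ j * M $ i $ k + S i j * S i k) M"
proof -
  let ?P = "\<chi> i j k. M $ i $ j * M $ i $ k + S i j * S i k"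
  have "psd (?P $ i)" for i
  proof -
    have "x \<bullet> ((?P $ i) *v x) = (\<Sum>j\<in>UNIV. M $ i $ j * x $ j)\<^sup>2 + (\<Sum>j\<in>UNIV. S i j * x $ j)\<^sup>2" for x
      by (simp add: inner_matrix_sum power2_eq_square sum_product sum.distrib[symmetric])
        (intro sum.cong refl; simp add: algebra_simps)
    then show ?thesis
      by (simp add: psd_def) (simp add: transpose_def vec_eq_iff mult.commute)
  qed
  moreover have "0 \<le> slack (\<chi> i. 1) ?P M i j k" for i j k
  proof (cases "distinct [i, j, k]")
    case True
    then show ?thesis
      using triple[OF True] by (simp add: slack_def sym[of j i] sym[of k i] sym[of k j])
  next
    case False
    have S0: "S l l = 0" for l using skew[of l l] by simp
    have sq': "S l m * S l m = 1 - M $ l $ m * M $ l $ m" for l m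
      using sq[of l m] by (simp add: power2_eq_square)
    from False consider "i = j" | "i = k" | "j = k" by auto
    then show ?thesis
      by cases (simp_all add: slack_def S0 sq' diag sym)
  qed
  ultimately show ?thesis by (simp add: certifies_def)
qed

section \<open>Trigonometry of oriented triples\<close>

lemma cos_sum_cyclic:
  fixes p q r :: real
  assumes "p + q + r = pi"
  shows "cos p * cos r + cos p * cos q + cos r * cos q - sin p * sin r - sin p * sin q - sin r * sin q
    = - cos p - cos q - cos r"
proof -
  \<comment> \<open>The products on the left pair up into the cosines of these three sums.\<close>
  have "p + r = pi - q" "p + q = pi - r" "q + r = pi - p" using assms by auto
  then have "cos (p + r) = - cos q" "cos (p + q) = - cos r" "cos (q + r) = - cos p"
    by (simp_all only: cos_pi_minus)
  then show ?thesis by (simp add: cos_add algebra_simps)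
qed

lemma cos_half_sums:
  fixes s t :: real
  assumes "x + y = 2 * s" "y - x = 2 * t"
  shows "cos x + cos y = 2 * cos s * cos t"
proof -
  have "x = s - t" "y = s + t" using assms by auto
  then show ?thesis by (simp add: cos_add cos_diff)
qed

text \<open>Pairing the cosines extracts the common nonnegative factor 2 cos (u + v + w). What
  remains follows from sin (u + v) sin w being at most cos (u + v) cos w.\<close>

lemma cos_sum_transitive_aux:
  fixes u v w :: real
  assumes "0 \<le> u" "0 \<le> v" "0 \<le> w" "u + v + w \<le> pi / 2"
  shows "cos (2 * w) + cos (2 * u + 2 * v) \<le> cos (2 * u) + cos (2 * v) + cos (2 * u + 2 * w) + cos (2 * v + 2 * w)"
proof -
  define h where "h = u + v + w"
  have 1: "cos (2 * u) + cos (2 * v + 2 * w) = 2 * cos h * cos (v + w - u)"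
    by (rule cos_half_sums) (simp_all add: h_def)
  have 2: "cos (2 * v) + cos (2 * u + 2 * w) = 2 * cos h * cos (u + w - v)"
    by (rule cos_half_sums) (simp_all add: h_def)
  have 3: "cos (2 * w) + cos (2 * u + 2 * v) = 2 * cos h * cos (u + v - w)"
    by (rule cos_half_sums) (simp_all add: h_def)
  have "sin w \<le> sin (pi / 2 - (u + v))" "sin (u + v) \<le> sin (pi / 2 - w)"
    using assms by (auto intro!: sin_monotone_2pi_le)
  then have "sin w \<le> cos (u + v)" "sin (u + v) \<le> cos w"
    by (simp_all add: cos_sin_eq)
  moreover have "0 \<le> sin w" "0 \<le> sin (u + v)" "0 \<le> sin u" "0 \<le> sin v" "0 \<le> cos w"
    using assms pi_gt_zero by (auto intro!: sin_ge_zero cos_ge_zero)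
  ultimately have "sin (u + v) * sin w \<le> cos w * cos (u + v)" "0 \<le> cos w * (sin u * sin v)"
    by (auto intro!: mult_mono mult_nonneg_nonneg)
  moreover have "cos (v + w - u) + cos (u + w - v) = 2 * cos w * (cos u * cos v + sin u * sin v)"
    by (simp add: cos_add cos_diff sin_add sin_diff algebra_simps)
  moreover have "cos (u + v - w) = cos w * cos (u + v) + sin (u + v) * sin w"
    by (simp add: cos_diff)
  ultimately have "cos (u + v - w) \<le> cos (v + w - u) + cos (u + w - v)"
    by (simp add: cos_add algebra_simps)
  moreover have "0 \<le> 2 * cos h"
    using assms by (auto simp: h_def intro!: cos_ge_zero)
  ultimately have "2 * cos h * cos (u + v - w) \<le> 2 * cos h * (cos (v + w - u) + cos (u + w - v))"
    by (rule mult_left_mono)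
  with 1 2 3 show ?thesis by (simp add: algebra_simps)
qed

lemma cos_sum_transitive:
  fixes p q r :: real
  assumes "p \<le> pi" "q \<le> pi" "0 \<le> r" "pi + r \<le> p + q"
  shows "cos p * cos r + cos p * cos q + cos r * cos q + sin p * sin r - sin p * sin q + sin r * sin q
    \<le> - cos p - cos q - cos r"
proof -
  \<comment> \<open>Half supplements of the two large angles and half of the small one; the last
    assumption becomes \<open>u + v + w \<le> pi / 2\<close>.\<close>
  define u v w where "u = (pi - p) / 2" and "v = (pi - q) / 2" and "w = r / 2"
  have pqr: "p = pi - 2 * u" "q = pi - 2 * v" "r = 2 * w"
    by (simp_all add: u_def v_def w_def field_simps)
  have "cos (2 * w) + cos (2 * u + 2 * v) \<le> cos (2 * u) + cos (2 * v) + cos (2 * u + 2 * w) + cos (2 * v + 2 * w)"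
    using assms by (intro cos_sum_transitive_aux) (auto simp: u_def v_def w_def field_simps)
  then show ?thesis
    unfolding pqr cos_add by (simp add: cos_diff sin_diff algebra_simps)
qed

context covered_COP5
begin

text \<open>The relation \<open>R\<close> is a tournament on the five points. Every triple is a
  directed 3-cycle or transitive in it, and each kind is settled by one trigonometric lemma.\<close>

lemma cyclic_certificate:
  assumes D: "distinct [a, b, c, d, e]"
    and far: "ang a c = pi - ang a b - ang b c" "ang b d = pi - ang b c - ang c d"
      "ang c e = pi - ang c d - ang d e" "ang d a = pi - ang d e - ang e a"
      "ang e b = pi - ang e a - ang a b"
    and total: "ang a b + ang b c + ang c d + ang d e + ang e a \<le> pi"
  shows "\<exists>P. certifies (\<chi> i. 1) P M"
proof -
  have D': "distinct [e, d, c, b, a]" using D by auto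
  define R where "R = {(a, b), (b, c), (c, d), (d, e), (e, a), (c, a), (d, b), (e, c), (a, d), (b, e)}"
  define S where "S i j = (if (i, j) \<in> R then 1 else - 1) * sin (ang i j)" for i j
  note U = UNIV_I[where 'a = 5, unfolded UNIV_5_eq[OF D]]
  have "\<forall>i\<in>{a, b, c, d, e}. \<forall>j\<in>{a, b, c, d, e}. i \<noteq> j \<longrightarrow> ((j, i) \<in> R \<longleftrightarrow> (i, j) \<notin> R)"
    unfolding R_def using D D' by simp
  then have R_flip: "(j, i) \<in> R \<longleftrightarrow> (i, j) \<notin> R" if "i \<noteq> j" for i j
    using U that by blast
  have skew: "S j i = - S i j" for i j
    using R_flip[of i j] by (cases "i = j") (auto simp: S_def ang_refl ang_commute[of j i])
  define ok where "ok i j k \<longleftrightarrow>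
      M $ i $ j * M $ i $ k + M $ i $ j * M $ j $ k + M $ i $ k * M $ j $ k
        + S i j * S i k + S j i * S j k + S k i * S k j \<le> M $ i $ j + M $ i $ k + M $ j $ k" for i j k
  have perms: "ok i j k \<and> ok i k j \<and> ok j i k \<and> ok j k i \<and> ok k i j \<and> ok k j i" if "ok i j k" for i j k
    using that unfolding ok_def sym[of j i] sym[of k i] sym[of k j] by (simp add: algebra_simps)
  have cyc: "ok i j k" if "(i, j) \<in> R" "(j, k) \<in> R" "(k, i) \<in> R" "distinct [i, j, k]"
    and s: "ang i j + ang j k + ang i k = pi" for i j k
  proof -
    have "S i j = sin (ang i j)" "S j k = sin (ang j k)" "S k i = sin (ang i k)"
      using that by (auto simp: S_def ang_commute[of k i])
    moreover have "S j i = - S i j" "S k j = - S j k" "S i k = - S k i" by (rule skew)+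
    moreover have "M $ i $ j = - cos (ang i j)" "M $ j $ k = - cos (ang j k)" "M $ i $ k = - cos (ang i k)"
      by (simp_all add: cos_ang)
    ultimately show ?thesis
      using cos_sum_cyclic[OF s] unfolding ok_def by simp
  qed
  have tra: "ok i j k" if "(i, j) \<in> R" "(j, k) \<in> R" "(i, k) \<in> R"
    and s: "pi + ang i k \<le> ang i j + ang j k" for i j k
  proof -
    have "S i j = sin (ang i j)" "S j k = sin (ang j k)" "S i k = sin (ang i k)"
      using that by (auto simp: S_def)
    moreover have "S j i = - S i j" "S k j = - S j k" "S k i = - S i k" by (rule skew)+
    moreover have "M $ i $ j = - cos (ang i j)" "M $ j $ k = - cos (ang j k)" "M $ i $ k = - cos (ang i k)"
      by (simp_all add: cos_ang)
    ultimately show ?thesis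
      using cos_sum_transitive[OF ang_bounds(2) ang_bounds(2) ang_bounds(1) s] unfolding ok_def by simp
  qed
  \<comment> \<open>Three consecutive points: two forward sides and a backward diagonal form a
    directed 3-cycle with angle sum pi.\<close>
  have "ok a b c" "ok b c d" "ok c d e" "ok d e a" "ok e a b"
    by (rule cyc; use D D' far in \<open>simp add: R_def\<close>)+
  note near = this[THEN perms]
  \<comment> \<open>A side and the point opposite to it form a transitive triple. Its two diagonals
    exceed the side by at least pi exactly because the total is at most pi.\<close>
  have "ok c a d" "ok d b e" "ok e c a" "ok a d b" "ok b e c"
    by (rule tra; use D D' far total in \<open>simp add: R_def ang_commute[of c a] ang_commute[of d b]
      ang_commute[of e c] ang_commute[of a d] ang_commute[of b e] ang_commute[of a e]\<close>)+
  note this[THEN perms]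
  with near D D' have "\<forall>i\<in>{a, b, c, d, e}. \<forall>j\<in>{a, b, c, d, e}. \<forall>k\<in>{a, b, c, d, e}.
      distinct [i, j, k] \<longrightarrow> ok i j k"
    by simp
  then have "ok i j k" if "distinct [i, j, k]" for i j k
    using U that by blast
  then have "certifies (\<chi> i. 1) (\<chi> i j k. M $ i $ j * M $ i $ k + S i j * S i k) M"
    unfolding ok_def by (intro skew_certificate[OF sym diag skew])
      (simp_all add: S_def power_mult_distrib sin_squared_eq cos_ang)
  then show ?thesis ..
qed

end

lemma covered_certificate:
  fixes M :: "real ^ 5 ^ 5"
  assumes "M \<in> COP" "\<And>i. M $ i $ i = 1" "pairs_covered M"
  shows "\<exists>P. certifies (\<chi> i. 1) P M"
proof (cases "psd M")
  case True
  then show ?thesis by (intro exI[of _ "\<chi> i. M"] psd_certificate)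
next
  case False
  with assms have "covered_COP5 M" by (simp add: covered_COP5_def)
  then show ?thesis
    using covered_COP5.cyclic_angles covered_COP5.cyclic_certificate by metis
qed

section \<open>Reduction to covered matrices by duality\<close>

lemma bounded_vecI:
  fixes S :: "('a::real_normed_vector ^ 'n) set"
  assumes "\<And>x i. x \<in> S \<Longrightarrow> norm (x $ i) \<le> R"
  shows "bounded S"
  unfolding bounded_iff
proof (intro exI ballI)
  fix x assume "x \<in> S"
  have "norm x \<le> (\<Sum>i\<in>UNIV. norm (x $ i))"
    unfolding norm_vec_def by (rule L2_set_le_sum) simp
  also have "\<dots> \<le> (\<Sum>i\<in>(UNIV :: 'n set). R)"
    by (intro sum_mono assms \<open>x \<in> S\<close>)
  finally show "norm x \<le> (\<Sum>i\<in>(UNIV :: 'n set). R)" .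
qed

lemma norm_matrix_le:
  fixes A :: "real ^ 'n ^ 'm"
  shows "norm A \<le> (\<Sum>i\<in>UNIV. \<Sum>j\<in>UNIV. \<bar>A $ i $ j\<bar>)"
proof -
  have "norm A \<le> (\<Sum>i\<in>UNIV. norm (A $ i))"
    unfolding norm_vec_def[of A] by (rule L2_set_le_sum) simp
  also have "\<dots> \<le> (\<Sum>i\<in>UNIV. \<Sum>j\<in>UNIV. \<bar>A $ i $ j\<bar>)"
    by (intro sum_mono norm_le_l1_cart)
  finally show ?thesis .
qed

lemma bounded_matrixI:
  fixes S :: "(real ^ 'n ^ 'm) set"
  assumes "\<And>A i j. A \<in> S \<Longrightarrow> \<bar>A $ i $ j\<bar> \<le> R"
  shows "bounded S"
  unfolding bounded_iff
proof (intro exI ballI)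
  fix A assume "A \<in> S"
  have "norm A \<le> (\<Sum>i\<in>UNIV. \<Sum>j\<in>UNIV. \<bar>A $ i $ j\<bar>)" by (rule norm_matrix_le)
  also have "\<dots> \<le> (\<Sum>i\<in>(UNIV :: 'm set). \<Sum>j\<in>(UNIV :: 'n set). R)"
    by (intro sum_mono assms \<open>A \<in> S\<close>)
  finally show "norm A \<le> (\<Sum>i\<in>(UNIV :: 'm set). \<Sum>j\<in>(UNIV :: 'n set). R)" .
qed

lemma sym_iff: "transpose M = M \<longleftrightarrow> (\<forall>i j. M $ i $ j = M $ j $ i)"
  by (auto simp: transpose_def vec_eq_iff)

lemma closed_psd: "closed {A :: real ^ 'n ^ 'n. psd A}"
  unfolding psd_def sym_iff inner_matrix_sum
  by (intro closed_Collect_conj closed_Collect_all closed_Collect_eq closed_Collect_le continuous_intros)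

lemma COP_iff:
  "M \<in> COP \<longleftrightarrow> (\<forall>i j. M $ i $ j = M $ j $ i) \<and>
    (\<forall>x. (\<forall>i. 0 \<le> x $ i) \<longrightarrow> 0 \<le> (\<Sum>i\<in>UNIV. \<Sum>j\<in>UNIV. M $ i $ j * x $ i * x $ j))"
  by (simp add: COP_def sym_mats_def sym_iff inner_matrix_sum)

lemma closed_COP: "closed (COP :: (real ^ 'n ^ 'n) set)"
proof -
  have "closed {M :: real ^ 'n ^ 'n. (\<forall>i j. M $ i $ j = M $ j $ i) \<and>
    (\<forall>x. (\<forall>i. 0 \<le> x $ i) \<longrightarrow> 0 \<le> (\<Sum>i\<in>UNIV. \<Sum>j\<in>UNIV. M $ i $ j * x $ i * x $ j))}"
    by (intro closed_Collect_conj closed_Collect_all closed_Collect_imp closed_Collect_eq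
        closed_Collect_le continuous_intros open_Collect_const)
  then show ?thesis by (simp add: COP_iff[symmetric])
qed

lemma COP_add: "M \<in> COP \<Longrightarrow> N \<in> COP \<Longrightarrow> M + N \<in> COP"
  by (auto simp: COP_iff distrib_right sum.distrib)

lemma COP_scaleR: "M \<in> COP \<Longrightarrow> 0 \<le> c \<Longrightarrow> c *\<^sub>R M \<in> COP"
  by (auto simp: COP_def sym_mats_def sym_iff scaleR_matrix_vector_assoc[symmetric])

lemma psd_imp_COP: "psd M \<Longrightarrow> M \<in> COP"
  by (simp add: psd_def COP_def sym_mats_def)

lemma nonneg_imp_COP: "transpose M = M \<Longrightarrow> (\<And>i j. 0 \<le> M $ i $ j) \<Longrightarrow> M \<in> COP"
  by (auto simp: COP_iff sym_iff intro!: sum_nonneg)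

lemma psd_mat_1: "psd (mat 1)"
  by (simp add: psd_def transpose_mat)

lemma COP_diag_nonneg: "M \<in> COP \<Longrightarrow> 0 \<le> M $ i $ i"
  using COP_nonneg[of M "axis i 1"] by (simp add: inner_axis' matrix_axis) (simp add: axis_def)

lemma COP_pair_nonneg:
  assumes "M \<in> COP"
  shows "0 \<le> M $ i $ i + 2 * M $ i $ j + M $ j $ j"
  using COP_nonneg[OF assms, of "axis i 1 + axis j 1"]
  by (simp add: quad_add[OF COP_sym[OF assms]] inner_axis' matrix_axis) (simp add: axis_def)

definition unit_COP :: "(real ^ 'n ^ 'n) set" where
  "unit_COP = {M \<in> COP. \<forall>i. M $ i $ i = 1}"

lemma unit_COP_ge: "M \<in> unit_COP \<Longrightarrow> - 1 \<le> M $ i $ j"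
  using COP_pair_nonneg[of M i j] by (simp add: unit_COP_def)

lemma closed_unit_COP: "closed (unit_COP :: (real ^ 'n ^ 'n) set)"
proof -
  have *: "(unit_COP :: (real ^ 'n ^ 'n) set) = COP \<inter> {M. \<forall>i. M $ i $ i = 1}"
    by (auto simp: unit_COP_def)
  show ?thesis
    unfolding * by (intro closed_Int closed_COP closed_Collect_all closed_Collect_eq continuous_intros)
qed

section \<open>The trace inner product and the projection onto constant diagonals\<close>

definition outer :: "real ^ 'n \<Rightarrow> real ^ 'n ^ 'n" where
  "outer u = (\<chi> i j. u $ i * u $ j)"

text \<open>The orthogonal projection onto the symmetric matrices with constant diagonal.\<close>
definition avg_diag :: "real ^ 'n ^ 'n \<Rightarrow> real ^ 'n ^ 'n" where
  "avg_diag Y = (\<chi> i j. if i = j then (\<Sum>k\<in>UNIV. Y $ k $ k) / real CARD('n) else (Y $ i $ j + Y $ j $ i) / 2)"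

lemma inner_matrix: "A \<bullet> B = (\<Sum>i\<in>UNIV. \<Sum>j\<in>UNIV. A $ i $ j * B $ i $ j)"
  for A B :: "real ^ 'n ^ 'm"
  by (simp add: inner_vec_def)

lemma inner_outer: "A \<bullet> outer u = u \<bullet> (A *v u)"
  by (simp add: inner_matrix inner_matrix_sum outer_def mult.assoc)

lemma inner_split_diag:
  fixes A B :: "real ^ 'n ^ 'n"
  shows "A \<bullet> B = (\<Sum>k\<in>UNIV. A $ k $ k * B $ k $ k)
    + (\<Sum>i\<in>UNIV. \<Sum>j\<in>UNIV. if i = j then 0 else A $ i $ j * B $ i $ j)"
proof -
  have "A \<bullet> B = (\<Sum>i\<in>UNIV. \<Sum>j\<in>UNIV. (if i = j then A $ i $ j * B $ i $ j else 0)
      + (if i = j then 0 else A $ i $ j * B $ i $ j))"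
    unfolding inner_matrix by (intro sum.cong refl) auto
  then show ?thesis by (simp add: sum.distrib)
qed

lemma avg_diag_self_adjoint: "A \<bullet> avg_diag B = avg_diag A \<bullet> B"
proof -
  define s where "s = (\<Sum>i\<in>UNIV. \<Sum>j\<in>UNIV. if i = j then 0 else A $ i $ j * B $ i $ j)"
  have 1: "(\<Sum>i\<in>UNIV. \<Sum>j\<in>UNIV. if i = j then 0 else A $ i $ j * B $ j $ i) = 
    (\<Sum>i\<in>UNIV. \<Sum>j\<in>UNIV. if i = j then 0 else A $ j $ i * B $ i $ j)"
    by (subst sum.swap) (intro sum.cong refl, auto)
  have "(\<Sum>i\<in>UNIV. \<Sum>j\<in>UNIV. if i = j then 0 else A $ i $ j * avg_diag B $ i $ j) =
      s / 2 + (\<Sum>i\<in>UNIV. \<Sum>j\<in>UNIV. if i = j then 0 else A $ i $ j * B $ j $ i) / 2"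
    unfolding s_def sum_divide_distrib sum.distrib[symmetric]
    by (intro sum.cong refl) (auto simp: avg_diag_def field_simps)
  moreover have "(\<Sum>i\<in>UNIV. \<Sum>j\<in>UNIV. if i = j then 0 else avg_diag A $ i $ j * B $ i $ j) =
      s / 2 + (\<Sum>i\<in>UNIV. \<Sum>j\<in>UNIV. if i = j then 0 else A $ j $ i * B $ i $ j) / 2"
    unfolding s_def sum_divide_distrib sum.distrib[symmetric]
    by (intro sum.cong refl) (auto simp: avg_diag_def field_simps)
  moreover have "(\<Sum>k\<in>UNIV. A $ k $ k * avg_diag B $ k $ k) = (\<Sum>k\<in>UNIV. avg_diag A $ k $ k * B $ k $ k)"
    by (simp add: avg_diag_def sum_distrib_right[symmetric] sum_distrib_left[symmetric]
        sum_divide_distrib[symmetric] times_divide_eq_left[symmetric] del: times_divide_eq_left)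
  ultimately show ?thesis unfolding inner_split_diag[of A] inner_split_diag[of "avg_diag A"] 1 by simp
qed

lemma avg_diag_eq:
  fixes Z :: "real ^ 'n ^ 'n"
  assumes "\<And>i j. Z $ i $ j = Z $ j $ i" "\<And>i. Z $ i $ i = c"
  shows "avg_diag Z = Z"
  using assms by (simp add: avg_diag_def vec_eq_iff)

lemma unit_COP_avg_diag:
  assumes "M \<in> unit_COP"
  shows "avg_diag M = M"
proof (rule avg_diag_eq)
  show "M $ i $ j = M $ j $ i" for i j
    using assms by (intro sym_component) (simp add: unit_COP_def COP_sym)
  show "M $ i $ i = 1" for i
    using assms by (simp add: unit_COP_def)
qed

lemma compact_nonneg_simplex: "compact {u :: real ^ 'n. (\<forall>i. 0 \<le> u $ i) \<and> (\<Sum>i\<in>UNIV. u $ i) = 1}"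
proof (rule compact_eq_bounded_closed[THEN iffD2], rule conjI)
  show "closed {u :: real ^ 'n. (\<forall>i. 0 \<le> u $ i) \<and> (\<Sum>i\<in>UNIV. u $ i) = 1}"
    by (intro closed_Collect_conj closed_Collect_all closed_Collect_eq closed_Collect_le continuous_intros)
  show "bounded {u :: real ^ 'n. (\<forall>i. 0 \<le> u $ i) \<and> (\<Sum>i\<in>UNIV. u $ i) = 1}"
  proof (rule bounded_vecI)
    fix u :: "real ^ 'n" and i assume "u \<in> {u. (\<forall>i. 0 \<le> u $ i) \<and> (\<Sum>i\<in>UNIV. u $ i) = 1}"
    then show "norm (u $ i) \<le> 1"
      using member_le_sum[of i UNIV "\<lambda>i. u $ i"] by auto
  qed
qed

text \<open>By duality the minimality of \<open>M\<close> makes \<open>X\<close>, up to its diagonal, a completely positive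
  matrix orthogonal to \<open>M\<close>, hence a nonnegative combination of \<open>outer u\<close> for zeros \<open>u\<close> of \<open>M\<close>.\<close>
lemma minimizer_pairs_covered:
  fixes X M :: "real ^ 'n ^ 'n"
  assumes X: "\<And>i j. X $ i $ j = X $ j $ i" "\<And>i. X $ i $ i = \<kappa>" "\<And>i j. i \<noteq> j \<Longrightarrow> 0 < X $ i $ j"
    and M: "M \<in> unit_COP" and min: "\<And>N. N \<in> unit_COP \<Longrightarrow> X \<bullet> M \<le> X \<bullet> N"
  shows "pairs_covered M"
proof -
  define \<Delta> where "\<Delta> = {u :: real ^ 'n. (\<forall>i. 0 \<le> u $ i) \<and> (\<Sum>i\<in>UNIV. u $ i) = 1}"
  define B where "B = (\<lambda>u. avg_diag (outer u)) ` \<Delta>"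
  define v where "v = X \<bullet> M"
  \<comment> \<open>The multiple of the identity is chosen so that \<open>Z\<close> is orthogonal to
    \<open>M\<close>, whose trace is the dimension.\<close>
  define Z where "Z = X - (v / real CARD('n)) *\<^sub>R mat 1"
  let ?K = "conic hull (convex hull B)"
  have \<Delta>_ne: "(\<chi> i. 1 / real CARD('n)) \<in> \<Delta>" by (simp add: \<Delta>_def)
  have "continuous_on \<Delta> (\<lambda>u. avg_diag (outer u))"
    unfolding avg_diag_def outer_def
    apply (intro continuous_on_vec_lambda)
    subgoal for i j by (cases "i = j") (auto intro!: continuous_intros)
    done
  then have "compact B"
    unfolding B_def using compact_nonneg_simplex by (intro compact_continuous_image) (auto simp: \<Delta>_def)
  then have cB: "compact (convex hull B)" by (rule compact_convex_hull)
  have I_avg: "avg_diag (mat 1) = (mat 1 :: real ^ 'n ^ 'n)"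
    by (rule avg_diag_eq[of _ 1]) (auto simp: mat_def)
  have trace_pos: "0 < mat 1 \<bullet> avg_diag (outer u)" if "u \<in> \<Delta>" for u
  proof -
    have "mat 1 \<bullet> avg_diag (outer u) = u \<bullet> u"
      by (simp add: avg_diag_self_adjoint I_avg inner_outer)
    moreover have "u \<noteq> 0" using that by (auto simp: \<Delta>_def)
    ultimately show ?thesis by simp
  qed
  \<comment> \<open>Positive trace keeps 0 out of the hull, so the cone over this compact set is
    closed.\<close>
  have "convex hull B \<subseteq> {Y. 0 < mat 1 \<bullet> Y}"
    using trace_pos by (intro hull_minimal convex_halfspace_gt) (auto simp: B_def)
  then have 0: "0 \<notin> convex hull B" by auto
  have closed: "closed ?K" using cB 0 by (intro closed_conic_hull) auto
  have convex: "convex ?K" by (rule convex_conic_hull) (rule convex_convex_hull)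
  have Z_avg: "avg_diag Z = Z"
    by (rule avg_diag_eq[of _ "\<kappa> - v / real CARD('n)"]) (auto simp: Z_def X mat_def)
  have I_unit: "mat 1 \<bullet> N = (\<Sum>k\<in>UNIV. N $ k $ k)" for N :: "real ^ 'n ^ 'n"
    by (simp add: inner_matrix mat_def if_distrib[of "\<lambda>x. x * _"] cong: if_cong)
  \<comment> \<open>A functional separating \<open>Z\<close> from the cone projects to a copositive
    \<open>N\<close> with constant diagonal \<open>c\<close> and
    \<open>X \<bullet> N < v * c\<close>, which contradicts the minimality of
    \<open>M\<close>.\<close>
  have "Z \<in> ?K"
  proof (rule ccontr)
    assume "Z \<notin> ?K"
    then obtain a b where ab: "a \<bullet> Z < b" "\<And>Y. Y \<in> ?K \<Longrightarrow> b < a \<bullet> Y"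
      using separating_hyperplane_closed_point[OF convex closed] by blast
    have ne: "convex hull B \<noteq> {}" using \<Delta>_ne by (auto simp: B_def)
    then have "0 \<in> ?K" by (simp add: conic_hull_contains_0)
    then have b: "b < 0" using ab(2) by fastforce
    have nonneg: "0 \<le> a \<bullet> avg_diag (outer u)" if u: "u \<in> \<Delta>" for u
    proof (rule ccontr)
      assume neg: "\<not> 0 \<le> a \<bullet> avg_diag (outer u)"
      define y where "y = a \<bullet> avg_diag (outer u)"
      have y: "y < 0" using neg by (simp add: y_def)
      have "avg_diag (outer u) \<in> convex hull B" using u by (auto simp: B_def intro!: hull_inc)
      \<comment> \<open>Scaling by \<open>b / y\<close> brings the functional to the value
        \<open>b\<close> itself, where the separation is strict.\<close>
      moreover have "0 \<le> b / y" using y b by (simp add: divide_nonpos_neg)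
      ultimately have "(b / y) *\<^sub>R avg_diag (outer u) \<in> ?K"
        unfolding conic_hull_explicit by blast
      then have "b < a \<bullet> ((b / y) *\<^sub>R avg_diag (outer u))" by (rule ab(2))
      also have "\<dots> = b / y * y" by (simp add: y_def)
      finally show False using y by simp
    qed
    define N c where "N = avg_diag a" and "c = (\<Sum>k\<in>UNIV. a $ k $ k) / real CARD('n)"
    have N_diag: "N $ i $ i = c" for i by (simp add: N_def c_def avg_diag_def)
    have N_COP: "N \<in> COP"
      unfolding COP_def sym_mats_def
    proof (intro CollectI conjI allI impI)
      show "transpose N = N" by (simp add: sym_iff N_def avg_diag_def)
      fix x :: "real ^ 'n" assume x: "\<forall>i. 0 \<le> x $ i"
      show "0 \<le> x \<bullet> (N *v x)"
      proof (cases "x = 0")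
        case False
        define s where "s = (\<Sum>i\<in>UNIV. x $ i)"
        have "s \<noteq> 0"
          unfolding s_def using x False by (subst sum_nonneg_eq_0_iff) (auto simp: vec_eq_iff)
        then have s: "0 < s"
          using x sum_nonneg[of UNIV "\<lambda>i. x $ i"] by (simp add: s_def)
        have "(1 / s) *\<^sub>R x \<in> \<Delta>"
          using x s by (auto simp: \<Delta>_def s_def sum_divide_distrib[symmetric])
        from nonneg[OF this] have "0 \<le> (1 / s)\<^sup>2 * (x \<bullet> (N *v x))"
          by (simp only: avg_diag_self_adjoint inner_outer N_def[symmetric] quad_scaleR)
        then show ?thesis using s by (simp add: zero_le_mult_iff)
      qed simp
    qed
    have "c \<ge> 0" using COP_diag_nonneg[OF N_COP] N_diag by metis
    have "N \<bullet> Z < 0"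
      using ab(1) b by (simp add: N_def avg_diag_self_adjoint[symmetric] Z_avg)
    moreover have "N \<bullet> Z = X \<bullet> N - v * c"
      using I_unit[of N] by (simp add: Z_def inner_diff_right N_diag inner_commute)
    ultimately have less: "X \<bullet> N < v * c" by simp
    show False
    \<comment> \<open>With zero diagonal a copositive matrix is entrywise nonnegative; with positive
      diagonal \<open>N\<close> can be rescaled into \<open>unit_COP\<close>.\<close>
    proof (cases "c = 0")
      case True
      then have "0 \<le> N $ i $ j" for i j
        using COP_pair_nonneg[OF N_COP, of i j] by (simp add: N_diag)
      then have "0 \<le> X \<bullet> N"
        unfolding inner_matrix using X(3) N_diag True
        by (intro sum_nonneg) (metis less_imp_le mult_nonneg_nonneg mult_zero_right order_refl)
      with less True show False by simp
    next
      case False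
      with \<open>c \<ge> 0\<close> have "c > 0" by simp
      then have "(1 / c) *\<^sub>R N \<in> unit_COP"
        using N_COP by (simp add: unit_COP_def N_diag COP_scaleR)
      from min[OF this] have "v \<le> (X \<bullet> N) / c" by (simp add: v_def)
      with less \<open>c > 0\<close> show False by (simp add: pos_le_divide_eq)
    qed
  qed
  then obtain t Y where Y: "Z = t *\<^sub>R Y" "0 \<le> t" "Y \<in> convex hull B"
    by (auto simp: conic_hull_explicit)
  then obtain T w where T: "finite T" "T \<subseteq> B" "\<And>s. s \<in> T \<Longrightarrow> 0 \<le> w s" "(\<Sum>s\<in>T. w s *\<^sub>R s) = Y"
    unfolding convex_hull_explicit by auto
  have B_nonneg: "0 \<le> M \<bullet> s" if "s \<in> T" for s
  proof -
    have "s \<in> B" using that T(2) by blast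
    then obtain u where u: "u \<in> \<Delta>" "s = avg_diag (outer u)" unfolding B_def by blast
    have "M \<in> COP" "\<And>i. 0 \<le> u $ i" using M u(1) by (simp_all add: \<Delta>_def unit_COP_def)
    from COP_nonneg[OF this] show ?thesis
      by (simp add: u(2) avg_diag_self_adjoint inner_outer unit_COP_avg_diag[OF M])
  qed
  show ?thesis unfolding pairs_covered_def
  proof (intro allI impI)
    fix i j :: 'n assume ij: "i \<noteq> j"
    have Zij: "0 < Z $ i $ j" using X(3)[OF ij] ij by (simp add: Z_def mat_def)
    have "t \<noteq> 0" using Zij Y(1) by auto
    have "M \<bullet> Z = 0"
      using I_unit[of M] M by (simp add: Z_def inner_diff_right v_def inner_commute unit_COP_def)
    then have "M \<bullet> Y = 0" using Y(1) \<open>t \<noteq> 0\<close> by simp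
    then have "(\<Sum>s\<in>T. w s * (M \<bullet> s)) = 0"
      by (simp add: T(4)[symmetric] inner_sum_right)
    then have ws: "\<forall>s\<in>T. w s * (M \<bullet> s) = 0"
      \<comment> \<open>Every generator of positive weight is thus orthogonal to \<open>M\<close>
        and comes from a zero. A positive entry of \<open>Z\<close> at \<open>i\<close>,
        \<open>j\<close> requires one with \<open>u $ i * u $ j\<close> positive.\<close>
      by (subst (asm) sum_nonneg_eq_0_iff) (use T B_nonneg in auto)
    have "0 < Y $ i $ j"
      using Zij Y(1,2) by (simp add: zero_less_mult_iff)
    then have "0 < (\<Sum>s\<in>T. w s * s $ i $ j)"
      by (simp add: T(4)[symmetric])
    then obtain s where s: "s \<in> T" "0 < w s * s $ i $ j"
      by (metis (no_types, lifting) not_less sum_nonpos)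
    have "s \<in> B" using s(1) T(2) by blast
    then obtain u where u: "u \<in> \<Delta>" "s = avg_diag (outer u)" unfolding B_def by blast
    have "u \<bullet> (M *v u) = M \<bullet> s"
      by (simp add: u(2) avg_diag_self_adjoint inner_outer unit_COP_avg_diag[OF M])
    moreover have "w s \<noteq> 0" using s(2) by auto
    ultimately have "zero_of M u"
      using ws s(1) u(1) by (auto simp: zero_of_def \<Delta>_def)
    moreover have "u $ i * u $ j \<noteq> 0"
      using s(2) ij by (auto simp: u(2) avg_diag_def outer_def)
    ultimately show "\<exists>u. zero_of M u \<and> 0 < u $ i \<and> 0 < u $ j"
      using u(1) by (intro exI[of _ u]) (auto simp: \<Delta>_def less_le)
  qed
qed

text \<open>The functional separating \<open>M0\<close> from \<open>K\<close> is perturbed and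
  minimised over \<open>unit_COP\<close>. The minimiser has all pairs covered, so it lies in
  \<open>K\<close>, yet its value does not exceed that of \<open>M0\<close>.\<close>

lemma unit_COP_subset:
  fixes K :: "(real ^ 'n ^ 'n) set"
  assumes K: "closed K" "convex K" "K \<subseteq> unit_COP" "mat 1 \<in> K"
    and up: "\<And>M N. M \<in> K \<Longrightarrow> transpose N = N \<Longrightarrow> (\<And>i. N $ i $ i = 0) \<Longrightarrow> (\<And>i j. 0 \<le> N $ i $ j) \<Longrightarrow> M + N \<in> K"
    and covered: "\<And>M. M \<in> unit_COP \<Longrightarrow> pairs_covered M \<Longrightarrow> M \<in> K"
  shows "unit_COP \<subseteq> K"
proof (rule subsetI, rule ccontr)
  fix M0 :: "real ^ 'n ^ 'n" assume M0: "M0 \<in> unit_COP" "M0 \<notin> K"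
  obtain a b where ab: "a \<bullet> M0 < b" "\<And>N. N \<in> K \<Longrightarrow> b < a \<bullet> N"
    using separating_hyperplane_closed_point[OF K(2,1) M0(2)] by blast
  have a_nonneg: "0 \<le> a $ i $ j + a $ j $ i" if ij: "i \<noteq> j" for i j
  proof (rule ccontr)
    define E :: "real ^ 'n ^ 'n" where "E = axis i (axis j 1) + axis j (axis i 1)"
    assume neg: "\<not> 0 \<le> a $ i $ j + a $ j $ i"
    \<comment> \<open>Adding \<open>t *\<^sub>R E\<close> to the identity would lower the functional
      by the distance to \<open>b\<close>, hence to \<open>b\<close> or below.\<close>
    define t where "t = \<bar>a \<bullet> mat 1 - b\<bar> / - (a $ i $ j + a $ j $ i)"
    have t: "0 \<le> t" unfolding t_def using neg by (intro divide_nonneg_nonneg) auto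
    have "mat 1 + t *\<^sub>R E \<in> K"
      using t ij by (intro up[OF K(4)]) (auto simp: E_def sym_iff axis_def)
    then have "b < a \<bullet> (mat 1 + t *\<^sub>R E)" by (rule ab(2))
    moreover have "a \<bullet> E = a $ i $ j + a $ j $ i"
      by (simp add: E_def inner_add_right inner_axis)
    moreover have "t * (a $ i $ j + a $ j $ i) = - \<bar>a \<bullet> mat 1 - b\<bar>"
      using neg by (simp add: t_def field_simps)
    ultimately show False by (simp add: inner_add_right)
  qed
  define J :: "real ^ 'n ^ 'n" where "J = (\<chi> i j. 1)"
  \<comment> \<open>So small that adding a multiple of \<open>J\<close> keeps \<open>M0\<close>
    strictly below \<open>K\<close>; this works because entries at least - 1 bound
    \<open>J \<bullet> N\<close> from below.\<close>
  define \<epsilon> where "\<epsilon> = (b - a \<bullet> M0) / (\<bar>J \<bullet> M0\<bar> + J \<bullet> J + 1)"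
  have "0 \<le> J \<bullet> J" by simp
  then have pos: "0 < \<bar>J \<bullet> M0\<bar> + J \<bullet> J + 1" by linarith
  then have \<epsilon>: "0 < \<epsilon>" using ab(1) by (simp add: \<epsilon>_def)
  define X where "X = avg_diag a + \<epsilon> *\<^sub>R J"
  obtain \<kappa> where X_diag: "\<And>i. X $ i $ i = \<kappa>"
    by (simp add: X_def J_def avg_diag_def)
  have X_sym: "X $ i $ j = X $ j $ i" for i j
    by (simp add: X_def J_def avg_diag_def)
  have X_pos: "0 < X $ i $ j" if "i \<noteq> j" for i j
    using a_nonneg[OF that] \<epsilon> that by (simp add: X_def J_def avg_diag_def add_nonneg_pos)
  have X_inner: "X \<bullet> N = a \<bullet> N + \<epsilon> * (J \<bullet> N)" if "N \<in> unit_COP" for N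
    using that by (simp add: X_def inner_add_left avg_diag_self_adjoint[symmetric] unit_COP_avg_diag)
  have J_ge: "- (J \<bullet> J) \<le> J \<bullet> N" if "N \<in> unit_COP" for N
    unfolding inner_matrix sum_negf[symmetric] using unit_COP_ge[OF that] by (intro sum_mono) (simp add: J_def)
  have less: "X \<bullet> M0 < X \<bullet> N" if N: "N \<in> K" for N
  proof -
    have "J \<bullet> M0 - J \<bullet> N < \<bar>J \<bullet> M0\<bar> + J \<bullet> J + 1"
      using J_ge[of N] N K(3) by force
    then have "\<epsilon> * (J \<bullet> M0 - J \<bullet> N) < \<epsilon> * (\<bar>J \<bullet> M0\<bar> + J \<bullet> J + 1)"
      using \<epsilon> by (rule mult_strict_left_mono)
    also have "\<dots> = b - a \<bullet> M0" using pos by (simp add: \<epsilon>_def)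
    finally show ?thesis
      using ab(2)[OF N] N K(3) M0(1) by (auto simp: X_inner algebra_simps)
  qed
  define T where "T = unit_COP \<inter> {N. X \<bullet> N \<le> X \<bullet> M0}"
  have "compact T"
    unfolding compact_eq_bounded_closed
  proof
    show "closed T"
      unfolding T_def by (intro closed_Int closed_unit_COP closed_halfspace_le)
    define r where "r = X \<bullet> M0 - (\<Sum>i\<in>UNIV. \<Sum>j\<in>UNIV. X $ i $ j * (if i = j then 1 else - 1))"
    show "bounded T"
    proof (rule bounded_matrixI)
      fix N i j assume "N \<in> T"
      then have N: "N \<in> unit_COP" "X \<bullet> N \<le> X \<bullet> M0" by (auto simp: T_def)
      have diag: "N $ k $ k = 1" for k using N by (simp add: unit_COP_def)
      \<comment> \<open>The weighted excess of an entry over its lower bound - 1. It is nonnegative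
        and its total is bounded on \<open>T\<close>, so positive weights bound every off-diagonal
        entry.\<close>
      define g where "g k l = X $ k $ l * (N $ k $ l - (if k = l then 1 else - 1))" for k l
      have g: "0 \<le> g k l" for k l
        using X_pos[of k l] unit_COP_ge[OF N(1), of k l] by (cases "k = l") (auto simp: g_def diag)
      have "g i j \<le> (\<Sum>l\<in>UNIV. g i l)"
        by (rule member_le_sum) (auto simp: g)
      also have "\<dots> \<le> (\<Sum>k\<in>UNIV. \<Sum>l\<in>UNIV. g k l)"
        by (rule member_le_sum[of i UNIV "\<lambda>k. \<Sum>l\<in>UNIV. g k l"]) (auto simp: g intro: sum_nonneg)
      also have "\<dots> \<le> r"
        using N(2) by (simp add: g_def r_def inner_matrix right_diff_distrib sum_subtractf)
      finally have le: "g i j \<le> r" .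
      then have r: "0 \<le> r" using g[of i j] by linarith
      have sum_nn: "0 \<le> (\<Sum>l\<in>UNIV. r / \<bar>X $ k $ l\<bar>)" for k
        using r by (intro sum_nonneg divide_nonneg_nonneg) auto
      have "r / \<bar>X $ i $ j\<bar> \<le> (\<Sum>l\<in>UNIV. r / \<bar>X $ i $ l\<bar>)"
        by (rule member_le_sum[of j UNIV "\<lambda>l. r / \<bar>X $ i $ l\<bar>"]) (use r in auto)
      also have "\<dots> \<le> (\<Sum>k\<in>UNIV. \<Sum>l\<in>UNIV. r / \<bar>X $ k $ l\<bar>)"
        by (rule member_le_sum[of i UNIV "\<lambda>k. \<Sum>l\<in>UNIV. r / \<bar>X $ k $ l\<bar>"]) (use sum_nn in auto)
      finally have r2: "r / \<bar>X $ i $ j\<bar> \<le> (\<Sum>k\<in>UNIV. \<Sum>l\<in>UNIV. r / \<bar>X $ k $ l\<bar>)" .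
      show "\<bar>N $ i $ j\<bar> \<le> 1 + (\<Sum>k\<in>UNIV. \<Sum>l\<in>UNIV. r / \<bar>X $ k $ l\<bar>)"
      proof (cases "i = j")
        case True
        then show ?thesis using sum_nn by (simp add: diag sum_nonneg)
      next
        case False
        then have "N $ i $ j + 1 \<le> r / \<bar>X $ i $ j\<bar>"
          using le X_pos[OF False] by (simp add: g_def pos_le_divide_eq mult.commute)
        then show ?thesis
          using r2 unit_COP_ge[OF N(1), of i j] by linarith
      qed
    qed
  qed
  moreover have "T \<noteq> {}" using M0(1) by (auto simp: T_def)
  moreover have "continuous_on T (\<lambda>N. X \<bullet> N)" by (intro continuous_intros)
  ultimately have "\<exists>M\<in>T. \<forall>N\<in>T. X \<bullet> M \<le> X \<bullet> N" by (rule continuous_attains_inf)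
  then obtain M where M: "M \<in> T" "\<And>N. N \<in> T \<Longrightarrow> X \<bullet> M \<le> X \<bullet> N" by blast
  have M': "M \<in> unit_COP" "X \<bullet> M \<le> X \<bullet> M0" using M(1) by (auto simp: T_def)
  have min: "X \<bullet> M \<le> X \<bullet> N" if "N \<in> unit_COP" for N
    using M(2)[of N] M'(2) that by (cases "X \<bullet> N \<le> X \<bullet> M0") (auto simp: T_def)
  have "pairs_covered M"
    by (rule minimizer_pairs_covered[OF X_sym X_diag X_pos M'(1) min])
  with M'(1) have "M \<in> K" by (rule covered)
  from less[OF this] M'(2) show False by simp
qed

section \<open>Closedness and scaling\<close>

lemma psd_add: "psd A \<Longrightarrow> psd B \<Longrightarrow> psd (A + B)"
  by (simp add: psd_def sym_iff matrix_vector_mult_add_rdistrib inner_add_right)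

lemma psd_scaleR: "psd A \<Longrightarrow> 0 \<le> c \<Longrightarrow> psd (c *\<^sub>R A)"
  by (simp add: psd_def sym_iff scaleR_matrix_vector_assoc[symmetric])

text \<open>For a fixed multiplier the slack is linear in the pair of certificate and
  matrix.\<close>

lemma certifies_convex_combination:
  assumes "certifies p P M" "certifies p Q N" "0 \<le> s" "0 \<le> t" "s + t = 1"
  shows "certifies p (s *\<^sub>R P + t *\<^sub>R Q) (s *\<^sub>R M + t *\<^sub>R N)"
proof -
  have t: "t = 1 - s" using assms by simp
  have "slack p (s *\<^sub>R P + t *\<^sub>R Q) (s *\<^sub>R M + t *\<^sub>R N) i j k = s * slack p P M i j k + t * slack p Q N i j k" for i j k
    unfolding slack_def t by (simp add: algebra_simps)
  then show ?thesis
    using assms by (simp add: certifies_def psd_add psd_scaleR)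
qed

lemma certifies_add_nonneg:
  assumes "certifies p P M" "\<And>i. 0 \<le> p $ i" "\<And>i j. 0 \<le> N $ i $ j"
  shows "certifies p P (M + N)"
proof -
  have "slack p P (M + N) i j k = slack p P M i j k + (p $ i * N $ j $ k + p $ j * N $ i $ k + p $ k * N $ i $ j)" for i j k
    unfolding slack_def by (simp add: algebra_simps)
  then show ?thesis
    using assms by (simp add: certifies_def)
qed

text \<open>Stated over a commutative ring to serve both real values of the variables and
  polynomials.\<close>

lemma sum_symmetrized:
  fixes A :: "'n::finite \<Rightarrow> 'n \<Rightarrow> 'n \<Rightarrow> 'a::comm_ring_1"
  shows "(\<Sum>i\<in>UNIV. \<Sum>j\<in>UNIV. \<Sum>k\<in>UNIV. (A i j k + A j i k + A k i j) * (x i * x j * x k))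
    = 3 * (\<Sum>i\<in>UNIV. \<Sum>j\<in>UNIV. \<Sum>k\<in>UNIV. A i j k * (x i * x j * x k))"
proof -
  let ?S = "\<Sum>i\<in>UNIV. \<Sum>j\<in>UNIV. \<Sum>k\<in>UNIV. A i j k * (x i * x j * x k)"
  have 2: "(\<Sum>i\<in>UNIV. \<Sum>j\<in>UNIV. \<Sum>k\<in>UNIV. A j i k * (x i * x j * x k)) = ?S"
    by (subst sum.swap) (simp add: mult_ac)
  have "(\<Sum>i\<in>UNIV. \<Sum>j\<in>UNIV. \<Sum>k\<in>UNIV. A k i j * (x i * x j * x k)) =
      (\<Sum>i\<in>UNIV. \<Sum>k\<in>UNIV. \<Sum>j\<in>UNIV. A k i j * (x i * x j * x k))"
    by (intro sum.cong refl sum.swap)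
  also have "\<dots> = (\<Sum>k\<in>UNIV. \<Sum>i\<in>UNIV. \<Sum>j\<in>UNIV. A k i j * (x i * x j * x k))"
    by (rule sum.swap)
  also have "\<dots> = ?S" by (simp add: mult_ac)
  finally have 3: "(\<Sum>i\<in>UNIV. \<Sum>j\<in>UNIV. \<Sum>k\<in>UNIV. A k i j * (x i * x j * x k)) = ?S" .
  show ?thesis
    by (simp add: distrib_right sum.distrib 2 3)
qed

lemma slack_sum:
  fixes x p :: "real ^ 'n"
  shows "(\<Sum>i\<in>UNIV. \<Sum>j\<in>UNIV. \<Sum>k\<in>UNIV. slack p P M i j k * (x $ i * x $ j * x $ k))
    = 3 * ((p \<bullet> x) * (x \<bullet> (M *v x)) - (\<Sum>i\<in>UNIV. x $ i * (x \<bullet> ((P $ i) *v x))))"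
proof -
  have "(p \<bullet> x) * (x \<bullet> (M *v x)) - (\<Sum>i\<in>UNIV. x $ i * (x \<bullet> ((P $ i) *v x))) =
      (\<Sum>i\<in>UNIV. \<Sum>j\<in>UNIV. \<Sum>k\<in>UNIV. (p $ i * M $ j $ k - P $ i $ j $ k) * (x $ i * x $ j * x $ k))"
  proof -
    have "(p \<bullet> x) * (x \<bullet> (M *v x)) = (\<Sum>i\<in>UNIV. p $ i * x $ i * (x \<bullet> (M *v x)))"
      by (simp add: inner_vec_def[of p] sum_distrib_right)
    moreover have "p $ i * x $ i * (x \<bullet> (M *v x)) - x $ i * (x \<bullet> ((P $ i) *v x)) =
        (\<Sum>j\<in>UNIV. \<Sum>k\<in>UNIV. (p $ i * M $ j $ k - P $ i $ j $ k) * (x $ i * x $ j * x $ k))" for i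
      unfolding inner_matrix_sum sum_distrib_left sum_subtractf[symmetric]
      by (intro sum.cong refl) (simp add: algebra_simps)
    ultimately show ?thesis
      by (simp add: sum_subtractf[symmetric])
  qed
  then show ?thesis
    unfolding slack_def by (simp only: sum_symmetrized[of "\<lambda>i j k. p $ i * M $ j $ k - P $ i $ j $ k"])
qed

text \<open>Nonnegative slack bounds the weighted sum of the forms \<open>P $ i\<close> at
  \<open>x\<close>; each summand is nonnegative and has weight at least 1.\<close>

lemma certifies_bound:
  assumes "certifies p P M" "\<And>i. 1 \<le> x $ i"
  shows "x \<bullet> ((P $ i) *v x) \<le> (p \<bullet> x) * (x \<bullet> (M *v x))"
proof -
  have x: "0 \<le> x $ j" for j using assms(2)[of j] by linarith
  have P: "0 \<le> x \<bullet> ((P $ j) *v x)" for j using assms(1) by (simp add: certifies_def psd_def)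
  have "0 \<le> (\<Sum>i\<in>UNIV. \<Sum>j\<in>UNIV. \<Sum>k\<in>UNIV. slack p P M i j k * (x $ i * x $ j * x $ k))"
    using assms(1) by (intro sum_nonneg mult_nonneg_nonneg x) (simp add: certifies_def)
  then have 1: "(\<Sum>i\<in>UNIV. x $ i * (x \<bullet> ((P $ i) *v x))) \<le> (p \<bullet> x) * (x \<bullet> (M *v x))"
    by (simp add: slack_sum)
  have "1 * (x \<bullet> ((P $ i) *v x)) \<le> x $ i * (x \<bullet> ((P $ i) *v x))"
    by (intro mult_right_mono assms(2) P)
  also have "\<dots> \<le> (\<Sum>i\<in>UNIV. x $ i * (x \<bullet> ((P $ i) *v x)))"
    by (rule member_le_sum) (auto intro: mult_nonneg_nonneg x P)
  finally show ?thesis using 1 by simp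
qed

lemma psd_entry_bound:
  assumes A: "psd A" and diag: "\<And>i. A $ i $ i \<le> R"
  shows "\<bar>A $ i $ j\<bar> \<le> R"
proof -
  have t: "transpose A = A" using A by (simp add: psd_def)
  have "0 \<le> (axis i 1 + axis j s) \<bullet> (A *v (axis i 1 + axis j s))" for s
    using A by (simp add: psd_def)
  then have "0 \<le> A $ i $ i + 2 * s * A $ i $ j + s * s * A $ j $ j" for s
    by (simp add: quad_add[OF t] inner_axis' matrix_axis sym_component[OF t, of j i] algebra_simps)
  from this[of 1] this[of "- 1"] show ?thesis
    using diag[of i] diag[of j] by simp
qed

text \<open>Vectors with entries between 1 and 2 give bounds on the forms \<open>P $ i\<close>, and
  two such vectors differ by an axis vector. This makes certificates compact.\<close>

lemma certificate_entry_bound: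
  fixes p :: "real ^ 'n"
  assumes c: "certifies p P M" and p: "\<And>i. \<bar>p $ i\<bar> \<le> a" and M: "\<And>i j. \<bar>M $ i $ j\<bar> \<le> b"
    and R: "R = (\<Sum>i\<in>(UNIV :: 'n set). a * 2) * (\<Sum>i\<in>(UNIV :: 'n set). \<Sum>j\<in>(UNIV :: 'n set). b * 2 * 2)"
  shows "\<bar>P $ i $ j $ k\<bar> \<le> 4 * R"
proof -
  have psd: "psd (P $ i)" using c by (simp add: certifies_def)
  then have t: "transpose (P $ i) = P $ i" by (simp add: psd_def)
  have a0: "0 \<le> a" and b0: "0 \<le> b"
    using order.trans[OF abs_ge_zero p] order.trans[OF abs_ge_zero M] by auto
  have *: "x \<bullet> ((P $ i) *v x) \<le> R" if x: "\<And>i. 1 \<le> x $ i" "\<And>i. x $ i \<le> 2" for x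
  proof -
    have x': "\<bar>x $ i\<bar> \<le> 2" for i using x[of i] by linarith
    have "\<bar>p \<bullet> x\<bar> \<le> (\<Sum>i\<in>(UNIV :: 'n set). a * 2)"
      unfolding inner_vec_def
      by (intro order.trans[OF sum_abs] sum_mono) (simp only: abs_mult inner_real_def, intro mult_mono p x' a0 abs_ge_zero)
    moreover have "\<bar>x \<bullet> (M *v x)\<bar> \<le> (\<Sum>i\<in>(UNIV :: 'n set). \<Sum>j\<in>(UNIV :: 'n set). b * 2 * 2)"
      unfolding inner_matrix_sum
      by (intro order.trans[OF sum_abs] sum_mono) (simp only: abs_mult, intro mult_mono M x' b0 abs_ge_zero mult_nonneg_nonneg zero_le_numeral)
    ultimately have "\<bar>p \<bullet> x\<bar> * \<bar>x \<bullet> (M *v x)\<bar> \<le> R"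
      unfolding R using a0 by (intro mult_mono) auto
    then have "(p \<bullet> x) * (x \<bullet> (M *v x)) \<le> R"
      by (simp add: abs_mult[symmetric])
    then show ?thesis using certifies_bound[OF c x(1), of i] by linarith
  qed
  define o1 :: "real ^ 'n" where "o1 = (\<chi> i. 1)"
  have "P $ i $ l $ l \<le> 4 * R" for l
  proof -
    have 1: "o1 \<bullet> ((P $ i) *v o1) \<le> R" by (rule *) (simp_all add: o1_def)
    have 2: "(o1 + axis l 1) \<bullet> ((P $ i) *v (o1 + axis l 1)) \<le> R"
      by (rule *) (simp_all add: o1_def axis_def)
    \<comment> \<open>Parallelogram law for \<open>o1 + axis l 1\<close> and \<open>o1\<close>,
      whose difference is the axis vector and whose sum is the vector used here.\<close>
    have "0 \<le> (2 *\<^sub>R o1 + axis l 1) \<bullet> ((P $ i) *v (2 *\<^sub>R o1 + axis l 1))"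
      using psd by (simp add: psd_def)
    then have "axis l 1 \<bullet> ((P $ i) *v axis l 1) \<le>
        2 * ((o1 + axis l 1) \<bullet> ((P $ i) *v (o1 + axis l 1))) + 2 * (o1 \<bullet> ((P $ i) *v o1))"
      by (simp add: quad_add[OF t] matrix_vector_mult_scaleR)
    then show ?thesis using 1 2 by (simp add: inner_axis' matrix_axis)
  qed
  then show ?thesis by (rule psd_entry_bound[OF psd])
qed

text \<open>Along a convergent sequence of matrices the multipliers and certificates stay bounded,
  so a subsequence of them converges to a certificate of the limit.\<close>

lemma closed_certified:
  fixes W :: "(real ^ 'n) set"
  assumes W: "compact W"
  shows "closed {M. \<exists>p\<in>W. \<exists>P. certifies p P M}"
  unfolding closed_sequential_limits
proof (intro allI impI, elim conjE)
  fix M :: "nat \<Rightarrow> real ^ 'n ^ 'n" and L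
  assume M: "\<forall>n. M n \<in> {M. \<exists>p\<in>W. \<exists>P. certifies p P M}" and lim: "M \<longlonglongrightarrow> L"
  from M have "\<forall>n. \<exists>p P. p \<in> W \<and> certifies p P (M n)" by blast
  then obtain p P where pP: "\<And>n. p n \<in> W" "\<And>n. certifies (p n) (P n) (M n)" by metis
  obtain a where a: "\<And>x. x \<in> W \<Longrightarrow> norm x \<le> a"
    using compact_imp_bounded[OF W] by (auto simp: bounded_iff)
  have p: "\<bar>p n $ i\<bar> \<le> a" for n i
    using component_le_norm_cart[of "p n" i] a[OF pP(1)[of n]] by linarith
  obtain b where b: "\<And>n. norm (M n) \<le> b"
    using convergent_imp_bounded[OF lim] by (auto simp: bounded_iff)
  have Mb: "\<bar>M n $ i $ j\<bar> \<le> b" for n i j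
    using component_le_norm_cart[of "M n $ i" j] Finite_Cartesian_Product.norm_nth_le[of "M n" i] b[of n] by linarith
  obtain R where R: "\<And>n i j k. \<bar>P n $ i $ j $ k\<bar> \<le> R"
    using certificate_entry_bound[OF pP(2) p Mb refl] by blast
  have "bounded (range P)"
  proof (rule bounded_vecI)
    fix X i assume "X \<in> range P"
    then obtain n where X: "X = P n" by blast
    have "norm (X $ i) \<le> (\<Sum>j\<in>UNIV. \<Sum>k\<in>UNIV. \<bar>X $ i $ j $ k\<bar>)"
      by (rule norm_matrix_le)
    also have "\<dots> \<le> (\<Sum>j\<in>(UNIV :: 'n set). \<Sum>k\<in>(UNIV :: 'n set). R)"
      unfolding X by (intro sum_mono R)
    finally show "norm (X $ i) \<le> (\<Sum>j\<in>(UNIV :: 'n set). \<Sum>k\<in>(UNIV :: 'n set). R)" .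
  qed
  then have "compact (W \<times> closure (range P))"
    using W by (intro compact_Times) (simp_all add: compact_closure)
  moreover have "\<forall>n. (p n, P n) \<in> W \<times> closure (range P)"
    using pP(1) closure_subset by fastforce
  ultimately obtain l r where l: "l \<in> W \<times> closure (range P)" and r: "strict_mono r"
    and lim_r: "((\<lambda>n. (p n, P n)) \<circ> r) \<longlonglongrightarrow> l"
    by (rule seq_compactE[OF compact_imp_seq_compact])
  have lim_p: "(\<lambda>n. p (r n)) \<longlonglongrightarrow> fst l" and lim_P: "(\<lambda>n. P (r n)) \<longlonglongrightarrow> snd l"
    using tendsto_fst[OF lim_r] tendsto_snd[OF lim_r] by (simp_all add: o_def)
  have lim_M: "(\<lambda>n. M (r n)) \<longlonglongrightarrow> L"
    using LIMSEQ_subseq_LIMSEQ[OF lim r] by (simp add: o_def)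
  have "psd (snd l $ i)" for i
    using closed_sequentially[OF closed_psd, of "\<lambda>n. P (r n) $ i" "snd l $ i"] pP(2) tendsto_vec_nth[OF lim_P]
    by (simp add: certifies_def)
  moreover have "0 \<le> slack (fst l) (snd l) L i j k" for i j k
  proof (rule LIMSEQ_le_const)
    show "(\<lambda>n. slack (p (r n)) (P (r n)) (M (r n)) i j k) \<longlonglongrightarrow> slack (fst l) (snd l) L i j k"
      unfolding slack_def by (intro tendsto_intros lim_p lim_P lim_M)
    show "\<exists>N. \<forall>n\<ge>N. 0 \<le> slack (p (r n)) (P (r n)) (M (r n)) i j k"
      using pP(2) by (simp add: certifies_def)
  qed
  ultimately have "certifies (fst l) (snd l) L" by (simp add: certifies_def)
  then show "L \<in> {M. \<exists>p\<in>W. \<exists>P. certifies p P M}" using l by (auto simp: mem_Times_iff)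
qed

lemma unit_COP_certificate:
  fixes M :: "real ^ 5 ^ 5"
  assumes "M \<in> unit_COP"
  shows "\<exists>P. certifies (\<chi> i. 1) P M"
proof -
  \<comment> \<open>A common multiplier keeps \<open>K\<close> convex, and as a compact singleton it
    also gives closedness.\<close>
  define K :: "(real ^ 5 ^ 5) set" where "K = unit_COP \<inter> {M. \<exists>p\<in>{\<chi> i. 1}. \<exists>P. certifies p P M}"
  have K_iff: "M \<in> K \<longleftrightarrow> M \<in> unit_COP \<and> (\<exists>P. certifies (\<chi> i. 1) P M)" for M
    by (simp add: K_def)
  have "unit_COP \<subseteq> K"
  proof (rule unit_COP_subset)
    show "closed K"
      unfolding K_def by (intro closed_Int closed_unit_COP closed_certified) simp
    show "convex K"
    proof (rule convexI)
      fix M N :: "real ^ 5 ^ 5" and s t :: real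
      assume MN: "M \<in> K" "N \<in> K" "0 \<le> s" "0 \<le> t" "s + t = 1"
      have "s *\<^sub>R M + t *\<^sub>R N \<in> unit_COP"
        using MN by (auto simp: K_iff unit_COP_def intro!: COP_add COP_scaleR)
      then show "s *\<^sub>R M + t *\<^sub>R N \<in> K"
        using MN certifies_convex_combination unfolding K_iff by blast
    qed
    show "K \<subseteq> unit_COP" by (auto simp: K_iff)
    have "mat 1 \<in> (unit_COP :: (real ^ 5 ^ 5) set)"
      using psd_imp_COP[OF psd_mat_1] by (simp add: unit_COP_def mat_def)
    then show "mat 1 \<in> K"
      using psd_certificate[OF psd_mat_1] unfolding K_iff by blast
    show "M + N \<in> K" if MK: "M \<in> K" and "transpose N = N" "\<And>i. N $ i $ i = 0" "\<And>i j. 0 \<le> N $ i $ j" for M N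
    proof -
      have "M + N \<in> unit_COP"
        using that nonneg_imp_COP[of N] by (simp add: K_iff unit_COP_def COP_add)
      moreover obtain P where "certifies (\<chi> i. 1) P M" using MK unfolding K_iff by blast
      then have "certifies (\<chi> i. 1) P (M + N)"
        by (rule certifies_add_nonneg) (simp_all add: that)
      ultimately show ?thesis by (auto simp: K_iff)
    qed
    show "M \<in> K" if "M \<in> unit_COP" "pairs_covered M" for M
      using that covered_certificate[of M] by (simp add: K_iff unit_COP_def)
  qed
  with assms show ?thesis by (auto simp: K_iff)
qed

section \<open>Removing the normalisation of the diagonal\<close>

definition simplex_weights :: "(real ^ 'n) set" where
  "simplex_weights = {p. (\<forall>i. 0 \<le> p $ i) \<and> (\<Sum>i\<in>UNIV. p $ i) = 1}"

text \<open>Replacing x_i by x_i / d_i gives unit diagonal; transforming back turns the all-ones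
  multiplier into the sum of the d_i x_i, which division by \<open>s\<close> normalises.\<close>

lemma positive_diag_certificate:
  fixes M :: "real ^ 5 ^ 5"
  assumes M: "M \<in> COP" and diag: "\<And>i. 0 < M $ i $ i"
  shows "\<exists>p\<in>simplex_weights. \<exists>P. certifies p P M"
proof -
  define d where "d i = sqrt (M $ i $ i)" for i
  define s where "s = (\<Sum>i\<in>UNIV. d i)"
  have d: "0 < d i" "d i * d i = M $ i $ i" for i using diag[of i] by (auto simp: d_def)
  then have s: "0 < s" by (simp add: s_def sum_pos)
  define M' :: "real ^ 5 ^ 5" where "M' = (\<chi> i j. M $ i $ j / (d i * d j))"
  have "M' \<in> COP"
    unfolding COP_def sym_mats_def
  proof (intro CollectI conjI allI impI)
    show "transpose M' = M'"
      using sym_component[OF COP_sym[OF M]] by (simp add: sym_iff M'_def mult.commute)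
    fix x :: "real ^ 5" assume x: "\<forall>i. 0 \<le> x $ i"
    define y :: "real ^ 5" where "y = (\<chi> i. x $ i / d i)"
    have "0 \<le> y \<bullet> (M *v y)"
      using x d(1) by (intro COP_nonneg[OF M]) (simp add: y_def less_imp_le)
    also have "y \<bullet> (M *v y) = x \<bullet> (M' *v x)"
      unfolding inner_matrix_sum by (simp add: M'_def y_def field_simps)
    finally show "0 \<le> x \<bullet> (M' *v x)" .
  qed
  moreover have "M' $ i $ i = 1" for i using diag[of i] by (simp add: M'_def d(2))
  ultimately have "M' \<in> unit_COP" by (simp add: unit_COP_def)
  then obtain P where P: "certifies (\<chi> i. 1) P M'" using unit_COP_certificate by blast
  define p :: "real ^ 5" where "p = (\<chi> i. d i / s)"
  \<comment> \<open>Chosen so that the slack is multiplied by the positive factor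
    \<open>d i * d j * d k / s\<close>.\<close>
  define Q :: "real ^ 5 ^ 5 ^ 5" where "Q = (\<chi> i j k. d i * d j * d k / s * P $ i $ j $ k)"
  have "psd (Q $ i)" for i
    unfolding psd_def
  proof (intro conjI allI)
    have psd: "psd (P $ i)" using P by (simp add: certifies_def)
    then show "transpose (Q $ i) = Q $ i"
      using sym_component[of "P $ i"] by (simp add: sym_iff Q_def psd_def mult_ac)
    fix x :: "real ^ 5"
    define y :: "real ^ 5" where "y = (\<chi> j. d j * x $ j)"
    have "0 \<le> d i / s * (y \<bullet> ((P $ i) *v y))"
      using psd d(1)[of i] s by (simp add: psd_def)
    also have "\<dots> = x \<bullet> ((Q $ i) *v x)"
      unfolding inner_matrix_sum sum_distrib_left
      by (intro sum.cong refl) (simp add: Q_def y_def)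
    finally show "0 \<le> x \<bullet> ((Q $ i) *v x)" .
  qed
  moreover have "0 \<le> slack p Q M i j k" for i j k
  proof -
    have M_eq: "M $ i $ j = d i * d j * M' $ i $ j" for i j
      using d(1)[of i] d(1)[of j] by (simp add: M'_def)
    have "slack p Q M i j k = d i * d j * d k / s * slack (\<chi> i. 1) P M' i j k"
      unfolding slack_def M_eq by (simp add: p_def Q_def algebra_simps)
    also have "0 \<le> \<dots>"
      using P d(1) s by (simp add: certifies_def less_imp_le)
    finally show ?thesis .
  qed
  ultimately have "certifies p Q M" by (simp add: certifies_def)
  moreover have "p \<in> simplex_weights"
    using d(1) s by (simp add: simplex_weights_def p_def less_imp_le sum_divide_distrib[symmetric] s_def[symmetric])
  ultimately show ?thesis by blast
qed

text \<open>Adding a small multiple of the identity makes the diagonal positive. The multipliers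
  vary along the sequence, and compactness of the simplex allows the limit.\<close>

lemma COP_certificate:
  fixes M :: "real ^ 5 ^ 5"
  assumes M: "M \<in> COP"
  shows "\<exists>p\<in>simplex_weights. \<exists>P. certifies p P M"
proof -
  let ?Q = "{M :: real ^ 5 ^ 5. \<exists>p\<in>simplex_weights. \<exists>P. certifies p P M}"
  have "closed ?Q"
    using compact_nonneg_simplex by (intro closed_certified) (simp add: simplex_weights_def)
  moreover have "M + inverse (real (Suc n)) *\<^sub>R mat 1 \<in> ?Q" for n
  proof -
    have "M + inverse (real (Suc n)) *\<^sub>R mat 1 \<in> COP"
      using M psd_imp_COP[OF psd_mat_1] by (intro COP_add COP_scaleR) auto
    moreover have "0 < (M + inverse (real (Suc n)) *\<^sub>R mat 1) $ i $ i" for i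
      using COP_diag_nonneg[OF M, of i] by (simp add: mat_def add_nonneg_pos)
    ultimately show ?thesis using positive_diag_certificate by blast
  qed
  moreover have "(\<lambda>n. M + inverse (real (Suc n)) *\<^sub>R mat 1) \<longlonglongrightarrow> M + 0 *\<^sub>R mat 1"
    by (intro tendsto_intros LIMSEQ_inverse_real_of_nat)
  ultimately have "M + 0 *\<^sub>R mat 1 \<in> ?Q" by (rule closed_sequentially)
  then show ?thesis by simp
qed

section \<open>Polynomials\<close>

definition monom_val :: "real ^ 'n \<Rightarrow> 'n expo \<Rightarrow> real" where
  "monom_val x \<beta> = (\<Prod>i\<in>UNIV. x $ i ^ Poly_Mapping.lookup \<beta> i)"

definition peval :: "real ^ 'n \<Rightarrow> 'n rpoly \<Rightarrow> real" where
  "peval x p = (\<Sum>\<beta>\<in>Poly_Mapping.keys p. Poly_Mapping.lookup p \<beta> * monom_val x \<beta>)"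

lemma monom_val_add: "monom_val x (\<beta> + \<gamma>) = monom_val x \<beta> * monom_val x \<gamma>"
  by (simp add: monom_val_def lookup_add power_add prod.distrib)

lemma monom_val_var: "monom_val x (Poly_Mapping.single i 1) = x $ i"
proof -
  have "monom_val x (Poly_Mapping.single i 1) = (\<Prod>k\<in>UNIV. if i = k then x $ k else 1)"
    unfolding monom_val_def by (intro prod.cong refl) (simp add: lookup_single when_def)
  then show ?thesis by simp
qed

lemma monom_val_nonneg: "(\<And>i. 0 \<le> x $ i) \<Longrightarrow> 0 \<le> monom_val x \<beta>"
  by (simp add: monom_val_def prod_nonneg)

lemma peval_superset:
  assumes "finite B" "Poly_Mapping.keys p \<subseteq> B"
  shows "peval x p = (\<Sum>\<beta>\<in>B. Poly_Mapping.lookup p \<beta> * monom_val x \<beta>)"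
  unfolding peval_def using assms by (intro sum.mono_neutral_left) (auto simp: in_keys_iff)

lemma peval_add: "peval x (p + q) = peval x p + peval x q"
proof -
  let ?B = "Poly_Mapping.keys p \<union> Poly_Mapping.keys q"
  have "peval x (p + q) = (\<Sum>\<beta>\<in>?B. Poly_Mapping.lookup (p + q) \<beta> * monom_val x \<beta>)"
    by (rule peval_superset) (simp_all add: keys_add)
  also have "\<dots> = peval x p + peval x q"
    by (simp add: peval_superset[of ?B] lookup_add distrib_right sum.distrib)
  finally show ?thesis .
qed

lemma peval_single: "peval x (Poly_Mapping.single \<beta> c) = c * monom_val x \<beta>"
  by (simp add: peval_def)

lemma peval_zero: "peval x 0 = 0"
  by (simp add: peval_def)

lemma peval_sum: "peval x (sum f B) = (\<Sum>b\<in>B. peval x (f b))"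
  by (induction B rule: infinite_finite_induct) (simp_all add: peval_zero peval_add)

lemma sum_monomials:
  assumes "finite B" "Poly_Mapping.keys p \<subseteq> B"
  shows "(\<Sum>\<beta>\<in>B. Poly_Mapping.single \<beta> (Poly_Mapping.lookup p \<beta>)) = p"
proof (rule poly_mapping_eqI)
  fix \<gamma>
  have "(\<Sum>\<beta>\<in>B. Poly_Mapping.lookup (Poly_Mapping.single \<beta> (Poly_Mapping.lookup p \<beta>)) \<gamma>)
      = (\<Sum>\<beta>\<in>B. if \<beta> = \<gamma> then Poly_Mapping.lookup p \<beta> else 0)"
    by (intro sum.cong refl) (simp add: lookup_single when_def)
  also have "\<dots> = Poly_Mapping.lookup p \<gamma>"
    using assms by (auto simp: in_keys_iff)
  finally show "Poly_Mapping.lookup (\<Sum>\<beta>\<in>B. Poly_Mapping.single \<beta> (Poly_Mapping.lookup p \<beta>)) \<gamma> = Poly_Mapping.lookup p \<gamma>"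
    by (simp add: lookup_sum)
qed

lemma peval_mult: "peval x (p * q) = peval x p * peval x q"
proof -
  let ?s = "\<lambda>p :: 'n rpoly. \<Sum>\<beta>\<in>Poly_Mapping.keys p. Poly_Mapping.single \<beta> (Poly_Mapping.lookup p \<beta>)"
  have "peval x (p * q) = peval x (?s p * ?s q)"
    by (simp add: sum_monomials)
  also have "\<dots> = (\<Sum>\<beta>\<in>Poly_Mapping.keys p. \<Sum>\<gamma>\<in>Poly_Mapping.keys q.
      (Poly_Mapping.lookup p \<beta> * monom_val x \<beta>) * (Poly_Mapping.lookup q \<gamma> * monom_val x \<gamma>))"
    by (simp add: sum_product peval_sum mult_single peval_single monom_val_add mult_ac)
  also have "\<dots> = peval x p * peval x q"
    by (simp add: peval_def sum_product)
  finally show ?thesis .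
qed

lemma peval_sos: "sos p \<Longrightarrow> 0 \<le> peval x p"
proof -
  have "0 \<le> peval x (\<Sum>q\<leftarrow>qs. q ^ 2)" for qs
    by (induction qs) (simp_all add: peval_zero peval_add power2_eq_square peval_mult)
  then show "sos p \<Longrightarrow> 0 \<le> peval x p" by (auto simp: sos_def)
qed

lemma peval_H_cone:
  assumes "h \<in> H_cone r" "\<And>i. 0 \<le> x $ i"
  shows "0 \<le> peval x h"
proof -
  obtain \<sigma> where \<sigma>: "\<And>\<beta>. mdeg \<beta> \<in> {r, r + 2} \<Longrightarrow> sos (\<sigma> \<beta>)"
    and h: "h = (\<Sum>\<beta> | mdeg \<beta> \<in> {r, r + 2}. xpow \<beta> * \<sigma> \<beta>)"
    using assms(1) unfolding H_cone_def by blast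
  show ?thesis
    unfolding h peval_sum
    using \<sigma> assms(2) by (intro sum_nonneg) (auto simp: peval_mult xpow_def peval_single intro!: mult_nonneg_nonneg monom_val_nonneg peval_sos)
qed

lemma peval_N_cone:
  assumes "p \<in> N_cone r" "norm1 p = 1" "\<And>i. 0 < x $ i"
  shows "0 < peval x p"
proof -
  have "Poly_Mapping.keys p \<noteq> {}" using assms(2) by (auto simp: norm1_def)
  moreover have "0 < Poly_Mapping.lookup p \<beta>" if "\<beta> \<in> Poly_Mapping.keys p" for \<beta>
    using assms(1) that by (auto simp: N_cone_def in_keys_iff less_le)
  moreover have "0 < monom_val x \<beta>" for \<beta>
    using assms(3) by (simp add: monom_val_def prod_pos)
  ultimately show ?thesis
    unfolding peval_def by (intro sum_pos mult_pos_pos) auto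
qed

lemma peval_qform: "peval x (qform M) = x \<bullet> (M *v x)"
  by (simp add: qform_def peval_sum peval_single monom_val_add monom_val_var inner_matrix_sum mult.assoc del: One_nat_def)

text \<open>At points with positive coordinates the multiplier is positive and may be divided out;
  the boundary of the orthant follows by continuity.\<close>

lemma Q_tilde_subset_COP: "Q_tilde r \<subseteq> (COP :: (real ^ 'n ^ 'n) set)"
proof
  fix M :: "real ^ 'n ^ 'n" assume "M \<in> Q_tilde r"
  then obtain p where t: "transpose M = M" and p: "p \<in> N_cone r" "norm1 p = 1" "p * qform M \<in> H_cone r"
    by (auto simp: Q_tilde_def sym_mats_def)
  have pos: "0 \<le> x \<bullet> (M *v x)" if x: "\<And>i. 0 < x $ i" for x
  proof -
    have "0 \<le> peval x p * (x \<bullet> (M *v x))"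
      using peval_H_cone[OF p(3), of x] x by (simp add: peval_mult peval_qform less_imp_le)
    then show ?thesis using peval_N_cone[OF p(1,2) x] by (simp add: zero_le_mult_iff)
  qed
  have "0 \<le> x \<bullet> (M *v x)" if x: "\<forall>i. 0 \<le> x $ i" for x
  proof (rule LIMSEQ_le_const)
    define y :: "nat \<Rightarrow> real ^ 'n" where "y n = x + inverse (real (Suc n)) *\<^sub>R (\<chi> i. 1)" for n
    have "y \<longlonglongrightarrow> x + 0 *\<^sub>R (\<chi> i. 1)"
      unfolding y_def by (intro tendsto_intros LIMSEQ_inverse_real_of_nat)
    then have y: "y \<longlonglongrightarrow> x" by simp
    show "(\<lambda>n. y n \<bullet> (M *v y n)) \<longlonglongrightarrow> x \<bullet> (M *v x)"
      unfolding inner_matrix_sum by (intro tendsto_intros y)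
    show "\<exists>N. \<forall>n\<ge>N. 0 \<le> y n \<bullet> (M *v y n)"
      using x by (intro exI allI impI pos) (simp add: y_def add_nonneg_pos)
  qed
  then show "M \<in> COP" using t by (simp add: COP_def sym_mats_def)
qed

text \<open>Cholesky elimination: subtracting the outer square of a normalised row clears one
  diagonal entry, and diagonal entries that vanish keep vanishing.\<close>

lemma psd_outer_decomposition:
  fixes A :: "real ^ 'n ^ 'n"
  assumes "psd A"
  shows "\<exists>vs. A = (\<Sum>v\<leftarrow>vs. outer v)"
  using assms
proof (induction "card {i. A $ i $ i \<noteq> 0}" arbitrary: A rule: less_induct)
  case less
  note A = \<open>psd A\<close>
  have t: "transpose A = A" using A by (simp add: psd_def)
  have diag: "0 \<le> B $ i $ i" if "psd B" for B :: "real ^ 'n ^ 'n" and i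
    using COP_diag_nonneg[OF psd_imp_COP[OF that]] .
  show ?case
  proof (cases "\<exists>i. A $ i $ i \<noteq> 0")
    case False
    then have "\<bar>A $ i $ j\<bar> \<le> 0" for i j
      using psd_entry_bound[OF A, of 0] by simp
    then have "A = 0" by (simp add: vec_eq_iff)
    then show ?thesis by (intro exI[of _ "[]"]) simp
  next
    case True
    then obtain i where i: "A $ i $ i \<noteq> 0" by blast
    with diag[OF A, of i] have pos: "0 < A $ i $ i" by linarith
    define v where "v = (1 / sqrt (A $ i $ i)) *\<^sub>R A $ i"
    define B where "B = A - outer v"
    have v: "v $ j * v $ k = A $ i $ j * A $ i $ k / A $ i $ i" for j k
      using pos by (simp add: v_def)
    have vx: "(v \<bullet> x)\<^sup>2 = (A $ i \<bullet> x)\<^sup>2 / A $ i $ i" for x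
      using pos by (simp add: v_def power_divide)
    have B: "psd B"
      unfolding psd_def
    proof (intro conjI allI)
      show "transpose B = B"
        using sym_component[OF t] by (simp add: sym_iff B_def outer_def mult.commute)
      fix x :: "real ^ 'n"
      \<comment> \<open>The minimiser of the form of \<open>A\<close> on the line through
        \<open>x\<close> in direction \<open>i\<close>; completing the square there yields the form
        of \<open>B\<close>.\<close>
      define s where "s = - (A $ i \<bullet> x) / A $ i $ i"
      have Ax: "(A *v x) $ i = A $ i \<bullet> x"
        by (simp add: matrix_vector_mult_def inner_vec_def)
      have "0 \<le> (x + axis i s) \<bullet> (A *v (x + axis i s))" using A by (simp add: psd_def)
      also have "\<dots> = x \<bullet> (A *v x) + 2 * s * (A $ i \<bullet> x) + s * s * A $ i $ i"
        using inner_matrix_commute[OF t, of x "axis i s"]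
        by (simp add: quad_add[OF t] inner_axis' matrix_axis Ax)
      also have "\<dots> = x \<bullet> (A *v x) - (v \<bullet> x)\<^sup>2"
        unfolding vx using pos by (simp add: s_def field_simps power2_eq_square)
      also have "\<dots> = x \<bullet> (B *v x)"
        by (simp add: B_def matrix_vector_mult_diff_rdistrib inner_diff_right inner_matrix_sum[of x "outer v"])
          (simp add: outer_def inner_vec_def power2_eq_square sum_product mult_ac)
      finally show "0 \<le> x \<bullet> (B *v x)" .
    qed
    have B_diag: "B $ k $ k = A $ k $ k - A $ i $ k * A $ i $ k / A $ i $ i" for k
      by (simp add: B_def outer_def v)
    have "B $ i $ i = 0" using pos by (simp add: B_diag)
    moreover have "B $ k $ k = 0" if "A $ k $ k = 0" for k
    proof -
      have "0 \<le> A $ i $ k * A $ i $ k / A $ i $ i" using pos by simp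
      then show ?thesis using diag[OF B, of k] that by (simp add: B_diag)
    qed
    ultimately have "{k. B $ k $ k \<noteq> 0} \<subset> {k. A $ k $ k \<noteq> 0}" using i by auto
    then have "card {k. B $ k $ k \<noteq> 0} < card {k. A $ k $ k \<noteq> 0}"
      by (intro psubset_card_mono) auto
    from less.hyps[OF this B] obtain vs where "B = (\<Sum>v\<leftarrow>vs. outer v)" by blast
    then have "A = (\<Sum>v\<leftarrow>v # vs. outer v)" by (simp add: B_def algebra_simps)
    then show ?thesis by blast
  qed
qed

section \<open>Quadratic forms as polynomials, and degrees\<close>

abbreviation var :: "'n \<Rightarrow> 'n rpoly" where
  "var i \<equiv> Poly_Mapping.single (Poly_Mapping.single i 1) 1"

abbreviation const :: "real \<Rightarrow> 'n rpoly" where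
  "const c \<equiv> Poly_Mapping.single 0 c"

lemma qform_eq: "qform M = (\<Sum>i\<in>UNIV. \<Sum>j\<in>UNIV. const (M $ i $ j) * (var i * var j))"
  by (simp add: qform_def mult_single)

lemma qform_add: "qform (A + B) = qform A + qform B"
  by (simp add: qform_eq single_add distrib_right sum.distrib)

lemma qform_outer: "qform (outer v) = (\<Sum>i\<in>UNIV. const (v $ i) * var i)\<^sup>2"
  by (simp add: qform_def outer_def power2_eq_square sum_product mult_single)

lemma sos_qform:
  assumes "psd A"
  shows "sos (qform A)"
proof -
  obtain vs where vs: "A = (\<Sum>v\<leftarrow>vs. outer v)" using psd_outer_decomposition[OF assms] by blast
  have "qform (\<Sum>v\<leftarrow>vs. outer v) = (\<Sum>q\<leftarrow>map (\<lambda>v. \<Sum>i\<in>UNIV. const (v $ i) * var i) vs. q ^ 2)"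
    by (induction vs) (simp_all add: qform_add qform_outer, simp add: qform_def)
  then show ?thesis unfolding vs sos_def by blast
qed

lemma sos_const: "0 \<le> c \<Longrightarrow> sos (const c)"
  unfolding sos_def by (intro exI[of _ "[const (sqrt c)]"]) (simp add: power2_eq_square mult_single)

lemma mdeg_add: "mdeg (\<beta> + \<gamma>) = mdeg \<beta> + mdeg \<gamma>"
  by (simp add: mdeg_def lookup_add sum.distrib)

lemma mdeg_single: "mdeg (Poly_Mapping.single i n) = n"
proof -
  have "mdeg (Poly_Mapping.single i n) = (\<Sum>k\<in>UNIV. if i = k then n else 0)"
    unfolding mdeg_def by (intro sum.cong refl) (simp add: lookup_single when_def)
  then show ?thesis by simp
qed

lemma mdeg_eq_1:
  assumes "mdeg \<beta> = 1"
  shows "\<exists>i. \<beta> = Poly_Mapping.single i 1"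
proof -
  obtain i where i: "Poly_Mapping.lookup \<beta> i = 1" "\<And>j. i \<noteq> j \<Longrightarrow> Poly_Mapping.lookup \<beta> j = 0"
    using assms sum_eq_1_iff[OF finite, of "Poly_Mapping.lookup \<beta>" UNIV] by (auto simp: mdeg_def)
  then have "\<beta> = Poly_Mapping.single i 1"
    by (intro poly_mapping_eqI) (auto simp: lookup_single when_def)
  then show ?thesis ..
qed

lemma homogeneous_single: "mdeg \<beta> = d \<Longrightarrow> homogeneous d (Poly_Mapping.single \<beta> c)"
  by (auto simp: homogeneous_def)

lemma homogeneous_sum: "(\<And>b. b \<in> B \<Longrightarrow> homogeneous d (f b)) \<Longrightarrow> homogeneous d (sum f B)"
  using keys_sum[of f B] by (fastforce simp: homogeneous_def)

lemma deg_at_most_qform: "deg_at_most 2 (qform A)"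
proof -
  have "homogeneous 2 (qform A)"
    unfolding qform_def by (intro homogeneous_sum homogeneous_single) (simp add: mdeg_add mdeg_single)
  then show ?thesis by (auto simp: homogeneous_def deg_at_most_def)
qed

text \<open>The product of multiplier and form splits into the sum of x_i x^T P_i x and a cubic
  \<open>g\<close> with nonnegative coefficients, which supply the parts of degree 1 and degree 3 in
  \<open>H_cone\<close>.\<close>

lemma certifies_imp_Q_tilde:
  fixes M :: "real ^ 'n ^ 'n"
  assumes t: "transpose M = M" and p: "p \<in> simplex_weights" and c: "certifies p P M"
  shows "M \<in> Q_tilde 1"
proof -
  define f :: "'n rpoly" where "f = (\<Sum>i\<in>UNIV. const (p $ i) * var i)"
  have f_eq: "f = (\<Sum>i\<in>UNIV. Poly_Mapping.single (Poly_Mapping.single i 1) (p $ i))"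
    by (simp add: f_def mult_single)
  have f_nonneg: "0 \<le> Poly_Mapping.lookup f \<beta>" for \<beta>
    unfolding f_eq lookup_sum using p by (intro sum_nonneg) (simp add: lookup_single when_def simplex_weights_def)
  have "homogeneous 1 f"
    unfolding f_eq by (intro homogeneous_sum homogeneous_single) (simp add: mdeg_single)
  with f_nonneg have f_N: "f \<in> N_cone 1" by (simp add: N_cone_def)
  \<comment> \<open>With nonnegative coefficients the norm is the value at the all-ones
    point.\<close>
  have "norm1 f = peval (\<chi> i. 1) f"
    using f_nonneg by (simp add: norm1_def peval_def monom_val_def)
  also have "\<dots> = 1"
    using p by (simp add: f_eq peval_sum peval_single monom_val_var simplex_weights_def del: One_nat_def)
  finally have f_norm: "norm1 f = 1" .
  let ?x3 = "\<lambda>i j k. var i * var j * var k :: 'n rpoly"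
  have h: "f * qform M = (\<Sum>i\<in>UNIV. \<Sum>j\<in>UNIV. \<Sum>k\<in>UNIV. const (p $ i * M $ j $ k) * ?x3 i j k)"
  proof -
    have "f * qform M = (\<Sum>i\<in>UNIV. const (p $ i) * var i * qform M)"
      by (simp only: f_def sum_distrib_right)
    then show ?thesis
      unfolding qform_eq sum_distrib_left by (simp add: mult_single add_ac)
  qed
  \<comment> \<open>The third undoes the threefold count of the symmetrised sum.\<close>
  define g where "g = (\<Sum>i\<in>UNIV. \<Sum>j\<in>UNIV. \<Sum>k\<in>UNIV. const (slack p P M i j k / 3) * ?x3 i j k)"
  define a where "a i j k = (const ((p $ i * M $ j $ k - P $ i $ j $ k) / 3) :: 'n rpoly)" for i j k
  have "g = (\<Sum>i\<in>UNIV. \<Sum>j\<in>UNIV. \<Sum>k\<in>UNIV. (a i j k + a j i k + a k i j) * ?x3 i j k)"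
    unfolding g_def a_def slack_def add_divide_distrib single_add ..
  also have "\<dots> = 3 * (\<Sum>i\<in>UNIV. \<Sum>j\<in>UNIV. \<Sum>k\<in>UNIV. a i j k * ?x3 i j k)"
    by (rule sum_symmetrized)
  also have "\<dots> = (\<Sum>i\<in>UNIV. \<Sum>j\<in>UNIV. \<Sum>k\<in>UNIV. const (p $ i * M $ j $ k - P $ i $ j $ k) * ?x3 i j k)"
  proof -
    have third: "c / 3 + c / 3 + c / 3 = c" for c :: real by simp
    have "3 * (a i j k * ?x3 i j k) = const (p $ i * M $ j $ k - P $ i $ j $ k) * ?x3 i j k" for i j k
    proof -
      have "3 * a i j k = a i j k + a i j k + a i j k" by simp
      also have "\<dots> = const (p $ i * M $ j $ k - P $ i $ j $ k)"
        unfolding a_def single_add[symmetric] third ..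
      finally show ?thesis by (simp add: mult.assoc[symmetric])
    qed
    then show ?thesis by (simp add: sum_distrib_left)
  qed
  also have "\<dots> = f * qform M - (\<Sum>i\<in>UNIV. var i * qform (P $ i))"
  proof -
    have "(\<Sum>i\<in>UNIV. var i * qform (P $ i)) = (\<Sum>i\<in>UNIV. \<Sum>j\<in>UNIV. \<Sum>k\<in>UNIV. const (P $ i $ j $ k) * ?x3 i j k)"
      unfolding qform_eq sum_distrib_left by (simp only: mult_ac)
    then show ?thesis
      unfolding h by (simp only: sum_subtractf[symmetric] single_diff left_diff_distrib)
  qed
  finally have split: "f * qform M = (\<Sum>i\<in>UNIV. var i * qform (P $ i)) + g" by simp
  have g_eq: "g = (\<Sum>i\<in>UNIV. \<Sum>j\<in>UNIV. \<Sum>k\<in>UNIV. Poly_Mapping.single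
      (Poly_Mapping.single i 1 + Poly_Mapping.single j 1 + Poly_Mapping.single k 1) (slack p P M i j k / 3))"
    by (simp add: g_def mult_single)
  have g_nonneg: "0 \<le> Poly_Mapping.lookup g \<beta>" for \<beta>
    unfolding g_eq lookup_sum using c
    by (intro sum_nonneg) (simp add: lookup_single when_def certifies_def)
  have g_hom: "homogeneous 3 g"
    unfolding g_eq by (intro homogeneous_sum homogeneous_single) (simp add: mdeg_add mdeg_single)
  \<comment> \<open>An exponent of degree 1 determines its variable; the other relevant exponents
    have degree 3 and receive the coefficient of \<open>g\<close> as a constant.\<close>
  define \<sigma> where "\<sigma> \<beta> = (if mdeg \<beta> = 1 then qform (P $ (THE i. \<beta> = Poly_Mapping.single i 1))
      else const (Poly_Mapping.lookup g \<beta>))" for \<beta> :: "'n expo"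
  have var_inj: "Poly_Mapping.single i 1 = Poly_Mapping.single j (1 :: nat) \<longleftrightarrow> i = j" for i j :: 'n
    by (auto dest: arg_cong[of _ _ Poly_Mapping.keys])
  have \<sigma>_var: "\<sigma> (Poly_Mapping.single i 1) = qform (P $ i)" for i
    by (simp add: \<sigma>_def mdeg_single var_inj del: One_nat_def)
  have "f * qform M = (\<Sum>\<beta> | mdeg \<beta> \<in> {1, 1 + 2}. xpow \<beta> * \<sigma> \<beta>)"
  proof -
    have fin: "finite {\<beta> :: 'n expo. mdeg \<beta> = 1}" "finite {\<beta> :: 'n expo. mdeg \<beta> = 3}"
      by (rule finite_subset[OF _ finite_mdeg[of 1]]; auto)+
    have "{\<beta> :: 'n expo. mdeg \<beta> \<in> {1, 1 + 2}} = {\<beta>. mdeg \<beta> = 1} \<union> {\<beta>. mdeg \<beta> = 3}" by auto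
    then have "(\<Sum>\<beta> | mdeg \<beta> \<in> {1, 1 + 2}. xpow \<beta> * \<sigma> \<beta>) =
        (\<Sum>\<beta> | mdeg \<beta> = 1. xpow \<beta> * \<sigma> \<beta>) + (\<Sum>\<beta> | mdeg \<beta> = 3. xpow \<beta> * \<sigma> \<beta>)"
      using fin by (simp only:) (rule sum.union_disjoint, auto)
    moreover have "(\<Sum>\<beta> | mdeg \<beta> = 1. xpow \<beta> * \<sigma> \<beta>) = (\<Sum>i\<in>UNIV. var i * qform (P $ i))"
    proof -
      have "{\<beta> :: 'n expo. mdeg \<beta> = 1} = (\<lambda>i. Poly_Mapping.single i 1) ` UNIV"
        using mdeg_eq_1 by (auto simp: mdeg_single)
      moreover have "inj (\<lambda>i :: 'n. Poly_Mapping.single i (1 :: nat))"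
        by (rule injI) (simp add: var_inj del: One_nat_def)
      ultimately show ?thesis
        by (simp add: sum.reindex \<sigma>_var xpow_def del: One_nat_def)
    qed
    moreover have "(\<Sum>\<beta> | mdeg \<beta> = 3. xpow \<beta> * \<sigma> \<beta>) = g"
    proof -
      have "(\<Sum>\<beta> | mdeg \<beta> = 3. xpow \<beta> * \<sigma> \<beta>) = (\<Sum>\<beta> | mdeg \<beta> = 3. Poly_Mapping.single \<beta> (Poly_Mapping.lookup g \<beta>))"
        by (intro sum.cong refl) (simp add: \<sigma>_def xpow_def mult_single)
      also have "\<dots> = g"
        using g_hom fin by (intro sum_monomials) (auto simp: homogeneous_def)
      finally show ?thesis .
    qed
    ultimately show ?thesis using split by simp
  qed
  moreover have "sos (\<sigma> \<beta>) \<and> deg_at_most (1 + 2 - mdeg \<beta>) (\<sigma> \<beta>)" if \<beta>: "mdeg \<beta> \<in> {1, 1 + 2}" for \<beta>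
  proof (cases "mdeg \<beta> = 1")
    case True
    then obtain i where i: "\<beta> = Poly_Mapping.single i 1" using mdeg_eq_1 by blast
    show ?thesis
      using True c sos_qform[of "P $ i"] deg_at_most_qform[of "P $ i"]
      by (simp add: i \<sigma>_var certifies_def mdeg_single del: One_nat_def)
  next
    case False
    then show ?thesis
      using g_nonneg[of \<beta>] by (simp add: \<sigma>_def sos_const deg_at_most_def mdeg_def)
  qed
  moreover have "homogeneous (1 + 2) (f * qform M)"
    unfolding h by (intro homogeneous_sum) (simp add: mult_single homogeneous_single mdeg_add mdeg_single)
  ultimately have "f * qform M \<in> H_cone 1"
    unfolding H_cone_def by blast
  with f_N f_norm t show ?thesis by (auto simp: Q_tilde_def sym_mats_def)
qed

theorem corollary3p5:
  shows "(COP :: (real ^ 5 ^ 5) set) = Q_tilde 1"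
proof
  show "(COP :: (real ^ 5 ^ 5) set) \<subseteq> Q_tilde 1"
    using COP_certificate certifies_imp_Q_tilde COP_sym by blast
qed (rule Q_tilde_subset_COP)

end
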